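(* Let $R$ be a complete valuation ring which is not a field, whose field of fractions is algebraically closed. Then for any connected open subset $V\subseteq\mathbb{A}_R^1$ and any $\lambda_1,\lambda_2\in V$, there exist infinitely many paths in $V$ joining $\lambda_1$ and $\lambda_2$.
   Context: A valuation ring is an integral domain $R$ with field of fractions $K$ such that for every non-zero $x\in K$, $x\in R$ or $x^{-1}\in R$. It is a complete valuation ring if the totally ordered group $K^\times/R^\times$ is isomorphic to an ordered subgroup of $\mathbb{R}$ and $R$ is complete under the induced norm; equivalently, $R=\{a\in K:|a|\le1\}$ for a complete non-Archimedean valued field $(K,|\cdot|)$. $R$ carries the norm $|\cdot|$. $\mathbb{A}_R^1$ is the set of all non-zero multiplicative seminorms $\lambda$, written $\mathbf{p}\mapsto|\mathbf{p}|_\lambda$, on the polynomial ring $R[\mathbf{t}]$ whose restrictions to $R$ are contractive ($|a|_\lambda\le|a|$ for $a\in R$), with the topology of pointwise convergence. *)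

theory Defs
  imports "HOL-Analysis.Analysis" "HOL-Computational_Algebra.Fraction_Field"
begin

(* The ring R is the type 'r itself, and K = 'r fract is its field of fractions. *)

definition frac_embed :: "'r::idom \<Rightarrow> 'r fract" where
  "frac_embed a = Fract a 1"

(* The rank-one condition is encoded by the norm: for a multiplicative nrm with unit ball R,
   the map x \<mapsto> - ln (nrm x) is an order embedding of K\<^sup>* / R\<^sup>* into the additive group of
   the reals, and every such embedding arises in this way. Its image may be trivial, so fields
   are not excluded here. *)

locale complete_valuation_ring =
  fixes nrm :: "'r::idom fract \<Rightarrow> real"
  assumes valuation_ring:
      "x \<noteq> 0 \<Longrightarrow> x \<in> range frac_embed \<or> inverse x \<in> range frac_embed"
    and nrm_nonneg: "0 \<le> nrm x"
    and nrm_eq_0_iff: "nrm x = 0 \<longleftrightarrow> x = 0"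
    and nrm_mult: "nrm (x * y) = nrm x * nrm y"
    and nrm_add: "nrm (x + y) \<le> max (nrm x) (nrm y)"
    and nrm_le_1_iff: "nrm x \<le> 1 \<longleftrightarrow> x \<in> range frac_embed"
    and complete:
      "Metric_space.mcomplete (UNIV :: 'r set) (\<lambda>a b. nrm (frac_embed (a - b)))"
begin

lemma metric: "Metric_space (UNIV :: 'r set) (\<lambda>a b. nrm (frac_embed (a - b)))"
proof
  have embed_add: "frac_embed (a + b) = frac_embed a + frac_embed b" for a b :: 'r
    by (simp add: frac_embed_def)
  have one: "nrm 1 = 1"
    using nrm_mult[of 1 1] nrm_eq_0_iff[of 1] by simp
  have neg_one: "nrm (- 1) = 1"
    using nrm_mult[of "- 1" "- 1"] one nrm_nonneg[of "- 1"]
    by (simp add: flip: power2_eq_square) (simp add: power2_eq_1_iff)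
  fix a b c :: 'r
  show "0 \<le> nrm (frac_embed (a - b))" by (rule nrm_nonneg)
  have "frac_embed (a - b) = - 1 * frac_embed (b - a)" by (simp add: frac_embed_def)
  then show "nrm (frac_embed (a - b)) = nrm (frac_embed (b - a))"
    by (simp only: nrm_mult neg_one)
  show "nrm (frac_embed (a - b)) = 0 \<longleftrightarrow> a = b"
    by (simp add: nrm_eq_0_iff frac_embed_def Zero_fract_def eq_fract)
  have "frac_embed (a - c) = frac_embed (a - b) + frac_embed (b - c)"
    by (simp flip: embed_add)
  then show "nrm (frac_embed (a - c)) \<le> nrm (frac_embed (a - b)) + nrm (frac_embed (b - c))"
    using nrm_add[of "frac_embed (a - b)" "frac_embed (b - c)"]
      nrm_nonneg[of "frac_embed (a - b)"] nrm_nonneg[of "frac_embed (b - c)"]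
    by simp
qed

end

definition multiplicative_seminorm :: "('a::ring_1 \<Rightarrow> real) \<Rightarrow> bool" where
  "multiplicative_seminorm l \<longleftrightarrow>
     (\<forall>p. 0 \<le> l p) \<and> l 0 = 0 \<and> (\<forall>p. l (- p) = l p) \<and>
     (\<forall>p q. l (p + q) \<le> l p + l q) \<and> (\<forall>p q. l (p * q) = l p * l q)"

(* As subspaces of the type 'r poly \<Rightarrow> real, which carries the product topology, these sets have
   the topology of pointwise convergence. *)

definition affine_line :: "('r::idom fract \<Rightarrow> real) \<Rightarrow> ('r poly \<Rightarrow> real) set" where
  "affine_line nrm =
     {l. multiplicative_seminorm l \<and> (\<exists>p. l p \<noteq> 0) \<and> (\<forall>a. l [:a:] \<le> nrm (frac_embed a))}"

(* Paths are counted by their images, so that reparametrizing does not give a new path. Between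
   distinct points they are arcs, so that backtracking does not either; an arc cannot
   join a point to itself, hence the case distinction. *)

definition joining_paths :: "'a::topological_space set \<Rightarrow> 'a \<Rightarrow> 'a \<Rightarrow> 'a set set" where
  "joining_paths V x y =
     {path_image g | g. path g \<and> path_image g \<subseteq> V \<and> pathstart g = x \<and> pathfinish g = y \<and>
        (x \<noteq> y \<longrightarrow> arc g)}"

end

theory Submission
  imports Defs "HOL-Probability.Discrete_Topology" "HOL-Computational_Algebra.Polynomial_Factorial"
begin

text \<open>
  Let \<open>\<pi>\<close> be a non-zero non-unit of \<open>R\<close>. Because the value group has rank one, a point \<open>l\<close>
  of the affine line restricts to \<open>R\<close> as a power \<open>\<bar>a\<bar>\<^sup>s\<close> of the norm with \<open>s\<close> in \<open>[1, \<infinity>]\<close>, and this power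
  is determined by the scale \<open>l \<pi> \<in> [0, \<bar>\<pi>\<bar>]\<close> (lemma \<open>Aff_const\<close>). The affine line is thus a family
  of tree-like Berkovich lines over an interval of scales. The tree direction alone would allow at
  most one arc between two points; the scale is the second dimension in which to go around.

  Two tools make the line accessible without a classification of its points. Since \<open>K\<close> is
  algebraically closed, every polynomial over \<open>R\<close> is a product of constants and linear polynomials
  over \<open>R\<close>. So points (\<open>Aff_eqI\<close>) are determined by the scale and the values at linear
  polynomials, and neighbourhoods (\<open>tube_basis\<close>) by the scale and the distances
  \<open>l (bt - a) / l b\<close> to finitely many centres \<open>a / b\<close>. The second tool is \<open>flow l r\<close>, the
  Gauss norm of radius \<open>r\<close> of the Taylor expansion \<open>f (t + X)\<close>. It replaces each of these distances
  by its maximum with \<open>r\<close>. It moves \<open>l\<close> continuously up the tree, and once \<open>r\<close> reaches the distance of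
  \<open>l\<close> to some centre the result depends only on that centre, on \<open>r\<close> and on the scale
  (\<open>flow_eq_flow_eval_abs\<close>).

  A small neighbourhood of a point \<open>m\<close> can therefore be pushed up into a plane region, with
  the scale and the radius around one nearest centre as coordinates. A plane region stays
  connected when \<open>m\<close> is removed. A point whose ascent would hit \<open>m\<close> first changes its scale, either
  by raising the seminorm to a power or, at scale 0, by increasing the scale of an evaluation from
  which it flows (\<open>scale_path\<close>). So \<open>m\<close> has arbitrarily small neighbourhoods that are path connected both
  with and without \<open>m\<close> (\<open>tube_delete_path_connected\<close>, \<open>punctured_nbhds_Aff\<close>).

  By general topology, a connected open \<open>V\<close> remains path connected after the removal of finitely many
  points. If there were only finitely many arcs from \<open>l1\<close> to \<open>l2\<close>, then removing one interior point
  of each of them would leave a path, hence an arc, that is none of them. For \<open>l1 = l2\<close> one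
  runs back and forth along initial segments of an arc that starts at \<open>l1\<close>.
\<close>

section \<open>Arcs and deleted points in spaces of functions\<close>

text \<open>
  The off-diagonal pairs \<open>g x \<noteq> g y\<close> in the square are covered by the open sets on which a single
  coordinate tells the two values apart. The square is second countable, so countably many of
  these sets suffice.
\<close>

lemma countable_separating_coordinates:
  fixes g :: "real \<Rightarrow> 'i \<Rightarrow> real"
  assumes g: "continuous_on {0..1} g"
  obtains D where "countable D"
    "\<And>x y. x \<in> {0..1} \<Longrightarrow> y \<in> {0..1} \<Longrightarrow> \<forall>d\<in>D. g x d = g y d \<Longrightarrow> g x = g y"
proof -
  define S :: "(real \<times> real) set" where "S = {0..1} \<times> {0..1}"
  define F where "F d = {z \<in> S. g (fst z) d - g (snd z) d \<in> - {0}}" for d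
  have cont: "continuous_on {0..1} (\<lambda>x. g x d)" for d
    using g by (rule continuous_on_product_then_coordinatewise)
  have "continuous_on S (\<lambda>z. g (fst z) d - g (snd z) d)" for d
    unfolding S_def
    by (intro continuous_intros continuous_on_compose2[OF cont]) auto
  then have F_open: "openin (top_of_set S) (F d)" for d
    using continuous_openin_preimage_gen[of S "\<lambda>z. g (fst z) d - g (snd z) d" "- {0}"]
      open_Compl[OF closed_singleton[of "0::real"]]
    by (simp add: F_def vimage_def Int_def)
  then obtain \<F> where \<F>: "\<F> \<subseteq> range F" "countable \<F>" "\<Union>\<F> = \<Union>(range F)"
    using Lindelof_openin[of "range F" S] F_open by blast
  then obtain D where D: "countable D" "\<F> = F ` D"
    by (metis countable_subset_image)
  show ?thesis
  proof (rule that[OF D(1)])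
    fix x y :: real assume xy: "x \<in> {0..1}" "y \<in> {0..1}" "\<forall>d\<in>D. g x d = g y d"
    then have "(x, y) \<notin> \<Union>\<F>"
      unfolding D(2) F_def by auto
    then have "(x, y) \<notin> F d" for d
      unfolding \<F>(3) by blast
    then show "g x = g y"
      using xy by (auto simp: F_def S_def)
  qed
qed

text \<open>
  An uncountable product of lines is not metrizable, so the theorem that a path in a Banach space
  contains an arc does not apply directly. But countably many coordinates separate the
  points of the compact image of \<open>p\<close>; weighted and bounded, they embed it homeomorphically into the
  Banach space of bounded sequences, from where the arc is pulled back.
\<close>

lemma path_contains_arc_function_space:
  fixes p :: "real \<Rightarrow> 'i \<Rightarrow> real"
  assumes p: "path p" and ne: "pathstart p \<noteq> pathfinish p"
  obtains q where "arc q" "path_image q \<subseteq> path_image p"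
    "pathstart q = pathstart p" "pathfinish q = pathfinish p"
proof -
  have contp: "continuous_on {0..1} p" using p by (simp add: path_def)
  obtain D where D: "countable D"
    "\<And>x y. x \<in> {0..1} \<Longrightarrow> y \<in> {0..1} \<Longrightarrow> \<forall>d\<in>D. p x d = p y d \<Longrightarrow> p x = p y"
    using countable_separating_coordinates[OF contp] by blast
  have "D \<noteq> {}"
    using D(2)[of 0 1] ne by (auto simp: pathstart_def pathfinish_def)
  define d where "d = from_nat_into D"
  have ranged: "range d = D"
    unfolding d_def by (rule range_from_nat_into[OF \<open>D \<noteq> {}\<close> D(1)])
  \<comment> \<open>The weights tend to 0, so that closeness in finitely many coordinates gives closeness in the
    supremum norm.\<close>
  define \<phi> where "\<phi> z n = arctan (z (d n)) / real (Suc n)" for z :: "'i \<Rightarrow> real" and n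
  have \<phi>_bound: "\<bar>\<phi> z n\<bar> \<le> (pi / 2) / real (Suc n)" for z n
  proof -
    have "\<bar>arctan (z (d n))\<bar> \<le> pi / 2"
      using arctan_bounded[of "z (d n)"] by (auto simp: abs_le_iff)
    then show ?thesis
      using divide_right_mono[of _ "pi / 2" "real (Suc n)"] by (simp add: \<phi>_def del: of_nat_Suc)
  qed
  have \<phi>_bcont: "(\<lambda>k. \<phi> z (of_discrete k)) \<in> bcontfun" for z
  proof (rule bcontfun_normI)
    show "continuous_on UNIV (\<lambda>k. \<phi> z (of_discrete k))"
      by (simp add: continuous_on_open_vimage open_discrete)
    fix k :: "nat discrete"
    define n where "n = of_discrete k"
    have "(pi / 2) / real (Suc n) \<le> pi / 2"
      using pi_gt_zero by (simp add: field_simps)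
    then show "norm (\<phi> z (of_discrete k)) \<le> pi / 2"
      unfolding n_def[symmetric] using \<phi>_bound[of z n] unfolding real_norm_def by (rule order_trans[rotated])
  qed
  define h where "h z = Bcontfun (\<lambda>k. \<phi> z (of_discrete k))" for z
  have h_apply: "apply_bcontfun (h z) k = \<phi> z (of_discrete k)" for z k
    unfolding h_def using Bcontfun_inverse[OF \<phi>_bcont] by simp
  have conth: "continuous_on UNIV h"
    unfolding continuous_on_def
  proof
    fix z :: "'i \<Rightarrow> real"
    show "(h \<longlongrightarrow> h z) (at z)"
    proof (rule tendstoI)
      fix e :: real assume e: "0 < e"
      obtain N where N: "pi / e < real N" using reals_Archimedean2 by blast
      have "\<forall>\<^sub>F y in at z. \<forall>n\<in>{..<N}. dist (\<phi> y n) (\<phi> z n) < e / 2"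
      proof (rule eventually_ball_finite)
        show "\<forall>n\<in>{..<N}. \<forall>\<^sub>F y in at z. dist (\<phi> y n) (\<phi> z n) < e / 2"
        proof
          fix n
          have "continuous_on UNIV (\<lambda>y :: 'i \<Rightarrow> real. y (d n))"
            by (rule continuous_on_product_coordinates)
          then have "((\<lambda>y. y (d n)) \<longlongrightarrow> z (d n)) (at z)"
            by (simp add: continuous_on_def)
          then have "((\<lambda>y. \<phi> y n) \<longlongrightarrow> \<phi> z n) (at z)"
            unfolding \<phi>_def by (intro tendsto_intros) auto
          then show "\<forall>\<^sub>F y in at z. dist (\<phi> y n) (\<phi> z n) < e / 2"
            using tendstoD[of _ _ _ "e/2"] e by simp
        qed
      qed simp
      then show "\<forall>\<^sub>F y in at z. dist (h y) (h z) < e"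
      proof (rule eventually_mono)
        fix y assume y: "\<forall>n\<in>{..<N}. dist (\<phi> y n) (\<phi> z n) < e / 2"
        define B where "B = max (e / 2) (pi / real (Suc N))"
        have "dist (h y) (h z) \<le> B"
        proof (rule dist_bound)
          fix k :: "nat discrete"
          define n where "n = of_discrete k"
          have "dist (\<phi> y n) (\<phi> z n) \<le> B"
          proof (cases "n < N")
            case True
            then have "dist (\<phi> y n) (\<phi> z n) < e / 2" using y by blast
            then show ?thesis unfolding B_def by simp
          next
            case False
            then have "pi / real (Suc n) \<le> pi / real (Suc N)"
              by (intro divide_left_mono) auto
            moreover have "dist (\<phi> y n) (\<phi> z n) \<le> pi / real (Suc n)"
            proof -
              have "dist (\<phi> y n) (\<phi> z n) \<le> (pi / 2) / real (Suc n) + (pi / 2) / real (Suc n)"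
                using \<phi>_bound[of y n] \<phi>_bound[of z n] unfolding dist_real_def by linarith
              also have "\<dots> = pi / real (Suc n)"
                unfolding add_divide_distrib[symmetric] by simp
              finally show ?thesis .
            qed
            ultimately show ?thesis by (simp add: B_def)
          qed
          then show "dist (apply_bcontfun (h y) k) (apply_bcontfun (h z) k) \<le> B"
            by (simp add: h_apply n_def)
        qed
        moreover have "pi / real (Suc N) < e"
        proof -
          have "pi < e * real N" using N e by (simp add: field_simps)
          also have "\<dots> < e * real (Suc N)" using e by simp
          finally show ?thesis by (simp add: field_simps)
        qed
        then have "B < e" using e by (simp add: B_def)
        ultimately show "dist (h y) (h z) < e" by simp
      qed
    qed
  qed
  have injh: "inj_on h (path_image p)"
  proof (rule inj_onI)
    fix x y assume xy: "x \<in> path_image p" "y \<in> path_image p" "h x = h y"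
    then obtain s t where st: "s \<in> {0..1}" "t \<in> {0..1}" "x = p s" "y = p t"
      by (auto simp: path_image_def)
    have "\<phi> x n = \<phi> y n" for n
      using xy(3) h_apply[of x "discrete n"] h_apply[of y "discrete n"]
      by (simp add: discrete_inverse)
    then have "p s (d n) = p t (d n)" for n
      using arctan_eq_iff by (auto simp: \<phi>_def st)
    then show "x = y" using D(2)[OF st(1,2)] ranged st(3,4) by (metis imageE)
  qed
  obtain k where k: "homeomorphism (path_image p) (h ` path_image p) h k"
    using homeomorphism_compact[OF compact_path_image[OF p] _ refl injh]
      continuous_on_subset[OF conth] by blast
  have mem: "pathstart p \<in> path_image p" "pathfinish p \<in> path_image p" by auto
  have path_hp: "path (h \<circ> p)"
    using p conth by (intro path_continuous_image) (auto intro: continuous_on_subset)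
  have h_ne: "h (pathstart p) \<noteq> h (pathfinish p)"
    using injh mem ne by (meson inj_on_eq_iff)
  obtain q where q: "arc q" "path_image q \<subseteq> path_image (h \<circ> p)"
    "pathstart q = h (pathstart p)" "pathfinish q = h (pathfinish p)"
    by (rule path_contains_arc[OF path_hp pathstart_compose[of h p] pathfinish_compose[of h p] h_ne])
  have qsub: "path_image q \<subseteq> h ` path_image p"
    using q(2) by (simp add: path_image_compose)
  show ?thesis
  proof (rule that[of "k \<circ> q"])
    have "continuous_on (path_image q) k" "inj_on k (path_image q)"
      using k qsub
      by (auto simp: homeomorphism_def intro: continuous_on_subset inj_on_subset
          intro!: inj_on_inverseI[of _ h])
    then show "arc (k \<circ> q)"
      using q(1) path_continuous_image comp_inj_on
      unfolding arc_def path_image_def by blast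
    show "path_image (k \<circ> q) \<subseteq> path_image p"
      using k qsub by (auto simp: path_image_compose homeomorphism_def)
    show "pathstart (k \<circ> q) = pathstart p" "pathfinish (k \<circ> q) = pathfinish p"
      using k q(3,4) mem by (auto simp: pathstart_compose pathfinish_compose homeomorphism_def)
  qed
qed

text \<open>
  The local property from which both path connectedness of connected open sets and its stability
  under the deletion of points follow.
\<close>

definition punctured_nbhds :: "'a::topological_space set \<Rightarrow> bool" where
  "punctured_nbhds S \<longleftrightarrow> (\<forall>U x. openin (top_of_set S) U \<longrightarrow> x \<in> U \<longrightarrow>
     (\<exists>W. openin (top_of_set S) W \<and> x \<in> W \<and> W \<subseteq> U \<and> path_connected W \<and>
          path_connected (W - {x})))"

lemma punctured_nbhds_path_connected:
  assumes S: "punctured_nbhds S" and U: "openin (top_of_set S) U" "connected U"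
  shows "path_connected U"
  unfolding path_connected_component
proof (intro ballI)
  fix x y assume xy: "x \<in> U" "y \<in> U"
  \<comment> \<open>The path component of a point is open, and so is its complement.\<close>
  define C where "C = {y \<in> U. path_component U x y}"
  have US: "U \<subseteq> S" using U(1) by (rule openin_imp_subset)
  have "\<exists>W. openin (top_of_set U) W \<and> z \<in> W \<and>
          (\<forall>w\<in>W. path_component U z w)" if z: "z \<in> U" for z
  proof -
    obtain W where W: "openin (top_of_set S) W" "z \<in> W" "W \<subseteq> U" "path_connected W"
      using S U(1) z unfolding punctured_nbhds_def by blast
    then have "openin (top_of_set U) W"
      using US by (meson openin_subset_trans)
    moreover have "path_component U z w" if "w \<in> W" for w
      using W that path_component_of_subset path_connected_component by metis
    ultimately show ?thesis using W by blast
  qed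
  note nb = this
  have "openin (top_of_set U) C"
  proof (subst openin_subopen, intro ballI)
    fix z assume z: "z \<in> C"
    then obtain W where W: "openin (top_of_set U) W" "z \<in> W" "\<forall>w\<in>W. path_component U z w"
      using nb[of z] by (auto simp: C_def)
    then have "W \<subseteq> C"
      using z openin_imp_subset[OF W(1)] by (auto simp: C_def intro: path_component_trans)
    then show "\<exists>T. openin (top_of_set U) T \<and> z \<in> T \<and> T \<subseteq> C" using W by blast
  qed
  moreover have "openin (top_of_set U) (U - C)"
  proof (subst openin_subopen, intro ballI)
    fix z assume z: "z \<in> U - C"
    then obtain W where W: "openin (top_of_set U) W" "z \<in> W" "\<forall>w\<in>W. path_component U z w"
      using nb[of z] by auto
    then have "W \<subseteq> U - C"
      using z openin_imp_subset[OF W(1)]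
      by (auto simp: C_def) (meson path_component_trans path_component_sym)
    then show "\<exists>T. openin (top_of_set U) T \<and> z \<in> T \<and> T \<subseteq> U - C" using W by blast
  qed
  then have "closedin (top_of_set U) C"
    by (simp add: closedin_def C_def)
  ultimately have "C = {} \<or> C = U"
    using U(2) by (auto simp: connected_clopen)
  moreover have "x \<in> C" using xy by (simp add: C_def path_component_refl)
  ultimately show "path_component U x y" using xy by (auto simp: C_def)
qed

lemma closed_singleton_function_space:
  fixes x :: "'i \<Rightarrow> real"
  shows "closed {x}"
proof -
  have "{x} = (\<Inter>i. (\<lambda>y. y i) -` {x i})"
    by auto
  moreover have "closed ((\<lambda>y::'i \<Rightarrow> real. y i) -` {x i})" for i
    by (rule closed_vimage[OF closed_singleton]) simp
  ultimately show ?thesis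
    by (metis (no_types, lifting) closed_INT)
qed

text \<open>
  If \<open>U - {x}\<close> fell apart, then a connected deleted neighbourhood of \<open>x\<close> would lie in one of the two
  parts; adding \<open>x\<close> to that part would disconnect \<open>U\<close>.
\<close>

lemma punctured_nbhds_connected_delete:
  assumes S: "punctured_nbhds S" and U: "openin (top_of_set S) U" "connected U"
    and closed: "closed {x}"
  shows "openin (top_of_set S) (U - {x})" and "connected (U - {x})"
proof -
  show op: "openin (top_of_set S) (U - {x})"
    unfolding Diff_eq using U(1) closed by (intro openin_Int_open) (simp_all add: open_closed)
  show "connected (U - {x})"
  proof (cases "x \<in> U")
    case False
    then show ?thesis using U by simp
  next
    case x: True
    have False if E: "openin (top_of_set (U - {x})) E" "openin (top_of_set (U - {x})) E'"
      "U - {x} \<subseteq> E \<union> E'" "E \<inter> E' = {}" "E \<noteq> {}" "E' \<noteq> {}" for E E'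
    proof -
      obtain W where W: "openin (top_of_set S) W" "x \<in> W" "W \<subseteq> U" "path_connected (W - {x})"
        using S U(1) x unfolding punctured_nbhds_def by blast
      have one: False if E: "openin (top_of_set (U - {x})) E" "openin (top_of_set (U - {x})) E'"
        "U - {x} \<subseteq> E \<union> E'" "E \<inter> E' = {}" "E' \<noteq> {}" "W - {x} \<subseteq> E" for E E'
      proof -
        have "openin (top_of_set S) E" "openin (top_of_set S) E'"
          using E(1,2) op by (auto intro: openin_trans)
        then have "openin (top_of_set S) (E \<union> W)" "openin (top_of_set S) E'"
          using W(1) by auto
        moreover have sub: "E \<subseteq> U - {x}" "E' \<subseteq> U - {x}"
          using E(1,2) by (auto dest: openin_imp_subset)
        ultimately have "openin (top_of_set U) (E \<union> W)" "openin (top_of_set U) E'"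
          using W(3) openin_imp_subset[OF U(1)]
          by (auto intro!: openin_subset_trans[of S _ U])
        moreover have "U \<subseteq> (E \<union> W) \<union> E'" using E(3) W(2) by auto
        moreover have "(E \<union> W) \<inter> E' = {}" using E(4,6) sub by auto
        moreover have "E \<union> W \<noteq> {}" using W(2) by auto
        ultimately show False
          using U(2) \<open>E' \<noteq> {}\<close> unfolding connected_openin by blast
      qed
      have "W - {x} \<subseteq> U - {x}" using W(3) by auto
      then have "openin (top_of_set (W - {x})) ((W - {x}) \<inter> E)"
        "openin (top_of_set (W - {x})) ((W - {x}) \<inter> E')"
        using E(1,2) by (auto simp: openin_open)
      moreover have "connected (W - {x})" by (rule path_connected_imp_connected[OF W(4)])
      ultimately have "(W - {x}) \<inter> E = {} \<or> (W - {x}) \<inter> E' = {}"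
        using E(3,4) \<open>W - {x} \<subseteq> U - {x}\<close> unfolding connected_openin by blast
      then have "W - {x} \<subseteq> E \<or> W - {x} \<subseteq> E'"
        using E(3) \<open>W - {x} \<subseteq> U - {x}\<close> by auto
      then show False
        using one[of E E'] one[of E' E] E by (auto simp: Un_commute Int_commute)
    qed
    then show ?thesis unfolding connected_openin by blast
  qed
qed

lemma punctured_nbhds_connected_Diff_finite:
  assumes "punctured_nbhds S" and "openin (top_of_set S) U" "connected U" and "finite M"
    and "\<And>x. x \<in> M \<Longrightarrow> closed {x}"
  shows "openin (top_of_set S) (U - M) \<and> connected (U - M)"
  using assms(4,5)
proof induction
  case (insert x M)
  moreover have "U - insert x M = (U - M) - {x}" by auto
  ultimately show ?case
    using punctured_nbhds_connected_delete[OF assms(1), of "U - M" x] by simp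
qed (use assms in auto)

lemma eventually_open_function_space:
  fixes T :: "('i \<Rightarrow> real) set"
  assumes "open T" "x \<in> T" "\<And>i. ((\<lambda>y. y i) \<longlongrightarrow> x i) F"
  shows "eventually (\<lambda>y. y \<in> T) F"
proof -
  have "limitin (product_topology (\<lambda>i. euclidean) UNIV) (\<lambda>y. y) x F"
    using assms(3) by (simp add: limitin_componentwise)
  then show ?thesis using assms(1,2) by (simp add: limitin_def open_fun_def)
qed

lemma path_function_space:
  fixes g :: "real \<Rightarrow> 'i \<Rightarrow> real"
  assumes "\<And>i. continuous_on {0..1} (\<lambda>x. g x i)"
  shows "path g"
  unfolding path_def using assms by (rule continuous_on_coordinatewise_then_product)

lemma continuous_on_coordinate [simp]:
  "continuous_on S (\<lambda>y :: 'i \<Rightarrow> real. y i)"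
  by (rule continuous_on_subset[OF continuous_on_product_coordinates]) simp

lemma path_componentI:
  assumes "path g" "path_image g \<subseteq> S"
  shows "path_component S (pathstart g) (pathfinish g)"
  using assms unfolding path_component_def by blast

section \<open>Gauss norms and Taylor expansion\<close>
definition ultrametric_abs :: "('a::comm_ring_1 \<Rightarrow> real) \<Rightarrow> bool" where
  "ultrametric_abs N \<longleftrightarrow> (\<forall>x. 0 \<le> N x) \<and> N 0 = 0 \<and> N 1 = 1 \<and>
     (\<forall>x y. N (x + y) \<le> max (N x) (N y)) \<and> (\<forall>x y. N (x * y) = N x * N y)"

context
  fixes N :: "'a::comm_ring_1 \<Rightarrow> real"
  assumes N: "ultrametric_abs N"
begin

lemma ua_nonneg: "0 \<le> N x"
  and ua_0: "N 0 = 0"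
  and ua_1: "N 1 = 1"
  and ua_add: "N (x + y) \<le> max (N x) (N y)"
  and ua_mult: "N (x * y) = N x * N y"
  using N by (auto simp: ultrametric_abs_def)

lemma ua_minus: "N (- x) = N x"
proof -
  have "N (- 1) * N (- 1) = 1"
    using ua_mult[of "- 1" "- 1"] ua_1 by simp
  then have "N (- 1) = 1"
    using ua_nonneg[of "- 1"] by (simp add: square_eq_1_iff)
  then show ?thesis
    using ua_mult[of "- 1" x] by simp
qed

lemma ua_diff: "N (x - y) \<le> max (N x) (N y)"
  using ua_add[of x "- y"] by (simp add: ua_minus)

lemma ua_power: "N (x ^ n) = N x ^ n"
  by (induction n) (simp_all add: ua_1 ua_mult)

lemma ua_add_eq:
  assumes "N x < N y"
  shows "N (x + y) = N y"
  using ua_add[of x y] ua_diff[of "x + y" x] assms by auto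

lemma ua_sum_le:
  assumes "\<And>i. i \<in> A \<Longrightarrow> N (f i) \<le> B" "0 \<le> B"
  shows "N (sum f A) \<le> B"
  using assms
proof (induction A rule: infinite_finite_induct)
  case (insert i A)
  then show ?case using ua_add[of "f i" "sum f A"] by (fastforce simp: max_def split: if_splits)
qed (auto simp: ua_0)

lemma ua_sum_less:
  assumes "\<And>i. i \<in> A \<Longrightarrow> N (f i) < B" "0 < B"
  shows "N (sum f A) < B"
  using assms
proof (induction A rule: infinite_finite_induct)
  case (insert i A)
  then have "max (N (f i)) (N (sum f A)) < B" by auto
  then have "N (f i + sum f A) < B" by (rule le_less_trans[OF ua_add])
  then show ?case using insert.hyps by simp
qed (auto simp: ua_0)

lemma ultrametric_abs_imp_seminorm: "multiplicative_seminorm N"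
proof -
  have "N (x + y) \<le> N x + N y" for x y
    using ua_add[of x y] ua_nonneg[of x] ua_nonneg[of y] by linarith
  then show ?thesis
    unfolding multiplicative_seminorm_def by (simp add: ua_nonneg ua_0 ua_minus ua_mult)
qed

end

definition gauss_norm :: "('a::comm_ring_1 \<Rightarrow> real) \<Rightarrow> real \<Rightarrow> 'a poly \<Rightarrow> real" where
  "gauss_norm N r q = Max ((\<lambda>i. N (coeff q i) * r ^ i) ` {..degree q})"

lemma gauss_norm_attained:
  obtains i where "gauss_norm N r q = N (coeff q i) * r ^ i"
proof -
  have "gauss_norm N r q \<in> (\<lambda>i. N (coeff q i) * r ^ i) ` {..degree q}"
    unfolding gauss_norm_def by (rule Max_in) auto
  then show ?thesis using that by auto
qed

lemma gauss_norm_coeff_le: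
  assumes N: "ultrametric_abs N" and r: "0 \<le> r"
  shows "N (coeff q i) * r ^ i \<le> gauss_norm N r q"
proof (cases "i \<le> degree q")
  case True
  then show ?thesis unfolding gauss_norm_def by (intro Max_ge) auto
next
  case False
  then have "N (coeff q i) * r ^ i = 0"
    by (simp add: coeff_eq_0 ua_0[OF N])
  also have "0 \<le> N (coeff q 0) * r ^ 0" using ua_nonneg[OF N] by simp
  also have "\<dots> \<le> gauss_norm N r q"
    unfolding gauss_norm_def by (intro Max_ge imageI) auto
  finally show ?thesis .
qed

lemma gauss_norm_le_iff:
  assumes "ultrametric_abs N" and "0 \<le> r"
  shows "gauss_norm N r q \<le> B \<longleftrightarrow> (\<forall>i. N (coeff q i) * r ^ i \<le> B)"
  by (metis gauss_norm_attained gauss_norm_coeff_le[OF assms] order_trans)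

lemma gauss_norm_const:
  assumes N: "ultrametric_abs N" and r: "0 \<le> r"
  shows "gauss_norm N r [:c:] = N c"
  by (simp add: gauss_norm_def)

lemma gauss_norm_linear:
  assumes N: "ultrametric_abs N" and r: "0 \<le> r"
  shows "gauss_norm N r [:c, d:] = max (N c) (r * N d)"
proof (cases "d = 0")
  case True
  then show ?thesis using ua_nonneg[OF N, of c] by (simp add: gauss_norm_def ua_0[OF N])
next
  case False
  then have "{..degree [:c, d:]} = {0, 1}" by auto
  then show ?thesis by (simp add: gauss_norm_def mult.commute)
qed

lemma gauss_norm_0_radius:
  assumes N: "ultrametric_abs N"
  shows "gauss_norm N 0 q = N (coeff q 0)"
proof (rule antisym)
  show "gauss_norm N 0 q \<le> N (coeff q 0)"
    unfolding gauss_norm_le_iff[OF N order_refl]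
    by (auto simp: power_0_left ua_nonneg[OF N])
  show "N (coeff q 0) \<le> gauss_norm N 0 q"
    using gauss_norm_coeff_le[OF N order_refl, of q 0] by simp
qed

text \<open>
  The Gauss norm of a product is at least the product of the Gauss norms because, for the least
  indices \<open>i\<close> and \<open>j\<close> at which the two maxima are attained, the summand with these indices strictly
  dominates all others in the coefficient of degree \<open>i + j\<close>.
\<close>

lemma gauss_norm_mult:
  assumes N: "ultrametric_abs N" and r: "0 \<le> r"
  shows "gauss_norm N r (p * q) = gauss_norm N r p * gauss_norm N r q"
proof -
  define a where "a i = N (coeff p i) * r ^ i" for i
  define b where "b i = N (coeff q i) * r ^ i" for i
  define A where "A = gauss_norm N r p"
  define B where "B = gauss_norm N r q"
  have nonneg: "0 \<le> a i" "0 \<le> b i" for i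
    by (simp_all add: a_def b_def r ua_nonneg[OF N])
  have le: "a i \<le> A" "b i \<le> B" for i
    by (simp_all add: a_def b_def A_def B_def gauss_norm_coeff_le[OF N r])
  have term_eq: "N (coeff p i * coeff q (k - i)) * r ^ k = a i * b (k - i)" if "i \<le> k" for i k
  proof -
    have "r ^ k = r ^ i * r ^ (k - i)" using that by (simp flip: power_add)
    then show ?thesis by (simp add: a_def b_def ua_mult[OF N])
  qed
  have upper: "gauss_norm N r (p * q) \<le> A * B"
    unfolding gauss_norm_le_iff[OF N r]
  proof
    fix k
    have t: "N (coeff p i * coeff q (k - i)) * r ^ k \<le> A * B" if "i \<le> k" for i
      unfolding term_eq[OF that] using le nonneg by (intro mult_mono) (auto intro: order_trans)
    show "N (coeff (p * q) k) * r ^ k \<le> A * B"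
    proof (cases "r ^ k = 0")
      case True
      then show ?thesis
        unfolding True using order_trans[OF nonneg(1) le(1)] order_trans[OF nonneg(2) le(2)]
        by simp
    next
      case False
      then have rk: "0 < r ^ k" using r by (simp add: order_less_le del: power_eq_0_iff)
      have "N (\<Sum>i\<le>k. coeff p i * coeff q (k - i)) \<le> A * B / r ^ k"
        using t rk order_trans[OF nonneg(1) le(1)] order_trans[OF nonneg(2) le(2)]
        by (intro ua_sum_le[OF N]) (auto simp: pos_le_divide_eq)
      then show ?thesis using rk by (simp add: coeff_mult pos_le_divide_eq)
    qed
  qed
  have lower: "A * B \<le> gauss_norm N r (p * q)"
  proof (cases "A * B = 0")
    case True
    obtain i where "gauss_norm N r (p * q) = N (coeff (p * q) i) * r ^ i"
      by (rule gauss_norm_attained)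
    then show ?thesis unfolding True by (simp add: r ua_nonneg[OF N])
  next
    case False
    then have AB: "0 < A" "0 < B"
      using order_trans[OF nonneg(1) le(1)] order_trans[OF nonneg(2) le(2)]
      by (auto simp: order_less_le)
    define i where "i = (LEAST i. a i = A)"
    define j where "j = (LEAST j. b j = B)"
    have "\<exists>i. a i = A" "\<exists>j. b j = B"
      unfolding a_def b_def A_def B_def by (metis gauss_norm_attained)+
    then have ij: "a i = A" "b j = B"
      unfolding i_def j_def by (auto intro: LeastI_ex)
    have less_i: "a i' < A" if "i' < i" for i'
      using not_less_Least[of i' "\<lambda>i. a i = A"] that le(1)[of i']
      by (auto simp: i_def order_less_le)
    have less_j: "b j' < B" if "j' < j" for j'
      using not_less_Least[of j' "\<lambda>j. b j = B"] that le(2)[of j']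
      by (auto simp: j_def order_less_le)
    define k where "k = i + j"
    have AB_eq: "N (coeff p i * coeff q (k - i)) * r ^ k = A * B"
      using term_eq[of i k] ij by (simp add: k_def)
    then have "r ^ k \<noteq> 0" using AB by (metis less_irrefl mult_pos_pos mult_zero_right)
    then have rk: "0 < r ^ k" using r by (simp add: order_less_le del: power_eq_0_iff)
    define u where "u = A * B / r ^ k"
    have u: "0 < u" using AB rk by (simp add: u_def)
    have main: "N (coeff p i * coeff q (k - i)) = u"
      using AB_eq rk unfolding u_def by (metis less_irrefl nonzero_eq_divide_eq)
    have "N (\<Sum>l\<in>{..k} - {i}. coeff p l * coeff q (k - l)) < u"
    proof (rule ua_sum_less[OF N _ u])
      fix l assume l: "l \<in> {..k} - {i}"
      have "a l * b (k - l) < A * B"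
      proof (cases "l < i")
        case True
        have "a l * b (k - l) \<le> a l * B" using le nonneg by (intro mult_left_mono)
        also have "\<dots> < A * B" using less_i[OF True] AB by simp
        finally show ?thesis .
      next
        case False
        then have "k - l < j" using l by (auto simp: k_def)
        have "a l * b (k - l) \<le> A * b (k - l)" using le nonneg by (intro mult_right_mono)
        also have "\<dots> < A * B" using less_j[OF \<open>k - l < j\<close>] AB by simp
        finally show ?thesis .
      qed
      then show "N (coeff p l * coeff q (k - l)) < u"
        using term_eq[of l k] l rk by (simp add: u_def pos_less_divide_eq)
    qed
    then have "N ((\<Sum>l\<in>{..k} - {i}. coeff p l * coeff q (k - l)) + coeff p i * coeff q (k - i)) = u"
      using ua_add_eq[OF N] main by metis
    moreover have "coeff (p * q) k =
        (\<Sum>l\<in>{..k} - {i}. coeff p l * coeff q (k - l)) + coeff p i * coeff q (k - i)"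
      unfolding coeff_mult using sum.remove[of "{..k}" i "\<lambda>l. coeff p l * coeff q (k - l)"]
      by (simp add: k_def add.commute)
    ultimately have "N (coeff (p * q) k) = A * B / r ^ k"
      by (simp add: u_def)
    then have "N (coeff (p * q) k) * r ^ k = A * B"
      using rk by (metis less_irrefl nonzero_eq_divide_eq)
    then show ?thesis using gauss_norm_coeff_le[OF N r, of "p * q" k] by simp
  qed
  show ?thesis using upper lower by (simp add: A_def B_def)
qed

lemma gauss_norm_ultrametric_abs:
  assumes N: "ultrametric_abs N" and r: "0 \<le> r"
  shows "ultrametric_abs (gauss_norm N r)"
proof -
  have "0 \<le> gauss_norm N r q" for q
    by (metis gauss_norm_attained mult_nonneg_nonneg r ua_nonneg[OF N] zero_le_power)
  moreover have "gauss_norm N r 0 = 0"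
    using gauss_norm_const[OF N r, of 0] by (simp add: ua_0[OF N])
  moreover have "gauss_norm N r 1 = 1"
    using gauss_norm_const[OF N r, of 1] by (simp add: ua_1[OF N] one_pCons)
  moreover have "gauss_norm N r (p + q) \<le> max (gauss_norm N r p) (gauss_norm N r q)" for p q
    unfolding gauss_norm_le_iff[OF N r]
  proof
    fix i
    have "N (coeff (p + q) i) * r ^ i \<le> max (N (coeff p i)) (N (coeff q i)) * r ^ i"
      using r by (intro mult_right_mono) (auto simp: ua_add[OF N])
    also have "\<dots> = max (N (coeff p i) * r ^ i) (N (coeff q i) * r ^ i)"
      using r by (intro max_mult_distrib_right[THEN trans]) simp
    also have "\<dots> \<le> max (gauss_norm N r p) (gauss_norm N r q)"
      using gauss_norm_coeff_le[OF N r] by (intro max.mono)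
    finally show "N (coeff (p + q) i) * r ^ i \<le> max (gauss_norm N r p) (gauss_norm N r q)" .
  qed
  ultimately show ?thesis
    unfolding ultrametric_abs_def using gauss_norm_mult[OF N r] by blast
qed

lemma continuous_on_Max:
  fixes f :: "'i \<Rightarrow> 'a::topological_space \<Rightarrow> real"
  assumes "finite I" "I \<noteq> {}" "\<And>i. i \<in> I \<Longrightarrow> continuous_on S (f i)"
  shows "continuous_on S (\<lambda>x. Max ((\<lambda>i. f i x) ` I))"
  using assms
proof (induction I rule: finite_ne_induct)
  case (insert i I)
  then have "(\<lambda>x. Max ((\<lambda>i. f i x) ` insert i I)) = (\<lambda>x. max (f i x) (Max ((\<lambda>i. f i x) ` I)))"
    by (simp add: Max_insert)
  then show ?case using insert by (auto intro!: continuous_on_max)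
qed simp

lemma continuous_on_gauss_norm:
  fixes N :: "'x::topological_space \<Rightarrow> 'a::comm_ring_1 \<Rightarrow> real"
  assumes "\<And>i. continuous_on S (\<lambda>x. N x (coeff q i))" and "continuous_on S r"
  shows "continuous_on S (\<lambda>x. gauss_norm (N x) (r x) q)"
  unfolding gauss_norm_def using assms by (intro continuous_on_Max continuous_intros) auto

text \<open>
  The polynomial \<open>f (t + X)\<close> in the variable \<open>X\<close>, with coefficients in the polynomials in \<open>t\<close>.
\<close>

definition taylor_poly :: "'a::comm_ring_1 poly \<Rightarrow> 'a poly poly" where
  "taylor_poly f = pcompose (map_poly (\<lambda>c. [:c:]) f) [:[:0, 1:], 1:]"

lemma taylor_poly_add: "taylor_poly (f + g) = taylor_poly f + taylor_poly g"
proof -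
  have "map_poly (\<lambda>c. [:c:]) (f + g) = map_poly (\<lambda>c. [:c:]) f + map_poly (\<lambda>c. [:c:]) g"
    by (rule poly_eqI) (simp add: coeff_map_poly)
  then show ?thesis by (simp add: taylor_poly_def pcompose_add)
qed

lemma taylor_poly_mult: "taylor_poly (f * g) = taylor_poly f * taylor_poly g"
proof -
  have sum: "[:sum h A:] = (\<Sum>i\<in>A. [:h i:])" for h :: "nat \<Rightarrow> 'a" and A
  proof (induction A rule: infinite_finite_induct)
    case (insert i A)
    have "[:sum h (insert i A):] = [:h i:] + [:sum h A:]" using insert.hyps by simp
    then show ?case unfolding insert.IH using insert.hyps by simp
  qed auto
  have "map_poly (\<lambda>c. [:c:]) (f * g) = map_poly (\<lambda>c. [:c:]) f * map_poly (\<lambda>c. [:c:]) g"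
    by (rule poly_eqI) (simp add: coeff_map_poly coeff_mult sum mult.commute)
  then show ?thesis by (simp add: taylor_poly_def pcompose_mult)
qed

lemma taylor_poly_const: "taylor_poly [:c:] = [:[:c:]:]"
  by (simp add: taylor_poly_def map_poly_pCons pcompose_pCons)

lemma taylor_poly_linear: "taylor_poly [:c, d:] = [:[:c, d:], [:d:]:]"
  by (simp add: taylor_poly_def map_poly_pCons pcompose_pCons)

lemma coeff_taylor_poly_0: "coeff (taylor_poly f) 0 = f"
proof (induction f)
  case 0
  then show ?case by (simp add: taylor_poly_def)
next
  case (pCons c f)
  have "pCons c f = [:c:] + [:0, 1:] * f" by simp
  then have "taylor_poly (pCons c f) = taylor_poly [:c:] + taylor_poly [:0, 1:] * taylor_poly f"
    by (metis taylor_poly_add taylor_poly_mult)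
  then show ?case using pCons by (simp add: taylor_poly_const taylor_poly_linear coeff_mult)
qed

section \<open>The points of the line restricted to constants\<close>
lemma frac_embed_eq_to_fract: "frac_embed = to_fract"
  by (simp add: fun_eq_iff frac_embed_def to_fract_def)

locale nontrivial_valuation = complete_valuation_ring nrm
  for nrm :: "'r::idom fract \<Rightarrow> real" +
  fixes \<pi> :: 'r
  assumes \<pi>_nz: "\<pi> \<noteq> 0" and \<pi>_less_1: "nrm (to_fract \<pi>) < 1"
    and alg_closed: "0 < degree P \<Longrightarrow> \<exists>x. poly (P :: 'r fract poly) x = 0"
begin

lemma nrm_1: "nrm 1 = 1"
  using nrm_mult[of 1 1] nrm_eq_0_iff[of 1] by simp

lemma nrm_ultrametric_abs: "ultrametric_abs nrm"
  unfolding ultrametric_abs_def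
  using nrm_nonneg nrm_mult nrm_add nrm_1 nrm_eq_0_iff by blast

lemma nrm_pos_iff: "0 < nrm x \<longleftrightarrow> x \<noteq> 0"
  using nrm_nonneg[of x] nrm_eq_0_iff[of x] by linarith

lemma nrm_divide: "nrm (x / y) = nrm x / nrm y"
proof (cases "y = 0")
  case False
  then show ?thesis using nrm_mult[of "x / y" y] nrm_eq_0_iff[of y] by (simp add: eq_divide_eq)
qed (simp add: nrm_eq_0_iff[THEN iffD2])

lemma nrm_to_fract_le_1: "nrm (to_fract a) \<le> 1"
  using nrm_le_1_iff[of "to_fract a"] by (simp add: frac_embed_eq_to_fract)

lemma nrm_le_1E:
  assumes "nrm x \<le> 1"
  obtains a where "x = to_fract a"
  using assms nrm_le_1_iff[of x] by (auto simp: frac_embed_eq_to_fract)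

abbreviation \<pi>n :: real where "\<pi>n \<equiv> nrm (to_fract \<pi>)"

lemma \<pi>n_pos: "0 < \<pi>n"
  using \<pi>_nz by (simp add: nrm_pos_iff)

lemma ln_\<pi>n_neg: "ln \<pi>n < 0"
  using \<pi>n_pos \<pi>_less_1 by simp

text \<open>
  The power of the norm that takes the value \<open>\<sigma>\<close> at \<open>\<pi>\<close>. At \<open>\<sigma> = 0\<close> it is the trivial absolute value of
  the residue field, and then an absolute value on \<open>R\<close> only: the value 0 at elements of norm greater
  than 1 is a dummy. This is why the facts below assume \<open>0 < \<sigma>\<close> or norms at most 1.
\<close>

definition vabs :: "real \<Rightarrow> 'r fract \<Rightarrow> real" where
  "vabs \<sigma> x = (if nrm x = 1 then 1 else if x = 0 then 0 else \<sigma> powr (ln (nrm x) / ln \<pi>n))"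

lemma vabs_0_scale: "vabs 0 x = (if nrm x = 1 then 1 else 0)"
  by (simp add: vabs_def)

lemma vabs_pos_scale:
  assumes "0 < \<sigma>"
  shows "vabs \<sigma> x = nrm x powr (ln \<sigma> / ln \<pi>n)"
  using assms nrm_eq_0_iff[of x] nrm_pos_iff[of x]
  by (auto simp: vabs_def powr_def mult_ac)

lemma vabs_nonneg: "0 \<le> vabs \<sigma> x"
  by (simp add: vabs_def)

lemma vabs_zero: "vabs \<sigma> 0 = 0"
  using nrm_eq_0_iff[of 0] by (simp add: vabs_def)

lemma vabs_one: "vabs \<sigma> 1 = 1"
  by (simp add: vabs_def nrm_1)

lemma vabs_uniformizer: "0 \<le> \<sigma> \<Longrightarrow> vabs \<sigma> (to_fract \<pi>) = \<sigma>"
  using \<pi>_less_1 ln_\<pi>n_neg \<pi>_nz by (auto simp: vabs_def)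

lemma vabs_mult:
  assumes "0 \<le> \<sigma>" "0 < \<sigma> \<or> nrm x \<le> 1 \<and> nrm y \<le> 1"
  shows "vabs \<sigma> (x * y) = vabs \<sigma> x * vabs \<sigma> y"
proof (cases "0 < \<sigma>")
  case True
  then show ?thesis by (simp add: vabs_pos_scale nrm_mult powr_mult nrm_nonneg)
next
  case False
  then have "\<sigma> = 0" "nrm x \<le> 1" "nrm y \<le> 1" using assms by auto
  moreover have "nrm x * nrm y = 1 \<longleftrightarrow> nrm x = 1 \<and> nrm y = 1"
  proof
    assume *: "nrm x * nrm y = 1"
    have "nrm x * nrm y \<le> nrm x" "nrm x * nrm y \<le> nrm y"
      using calculation nrm_nonneg by (simp_all add: mult_left_le mult_left_le_one_le)
    then show "nrm x = 1 \<and> nrm y = 1" using * calculation by linarith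
  qed simp
  ultimately show ?thesis by (simp add: vabs_0_scale nrm_mult)
qed

lemma ln_scale_pos:
  assumes "0 < \<sigma>" "\<sigma> \<le> \<pi>n"
  shows "1 \<le> ln \<sigma> / ln \<pi>n"
  using assms ln_\<pi>n_neg by (simp add: le_divide_eq)

lemma vabs_add:
  assumes "0 \<le> \<sigma>" "\<sigma> \<le> \<pi>n" "0 < \<sigma> \<or> nrm x \<le> 1 \<and> nrm y \<le> 1"
  shows "vabs \<sigma> (x + y) \<le> max (vabs \<sigma> x) (vabs \<sigma> y)"
proof (cases "0 < \<sigma>")
  case True
  define e where "e = ln \<sigma> / ln \<pi>n"
  have e: "0 \<le> e" using ln_scale_pos[OF True assms(2)] by (simp add: e_def)
  have "nrm (x + y) powr e \<le> max (nrm x) (nrm y) powr e"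
    using e nrm_nonneg nrm_add by (intro powr_mono2) auto
  also have "\<dots> \<le> max (nrm x powr e) (nrm y powr e)" by (auto simp: max_def)
  finally show ?thesis by (simp add: vabs_pos_scale True e_def)
next
  case False
  then have "\<sigma> = 0" "nrm x \<le> 1" "nrm y \<le> 1" using assms by auto
  then show ?thesis using nrm_add[of x y] by (auto simp: vabs_0_scale)
qed

lemma vabs_le_nrm:
  assumes "0 \<le> \<sigma>" "\<sigma> \<le> \<pi>n" "nrm x \<le> 1"
  shows "vabs \<sigma> x \<le> nrm x"
proof (cases "0 < \<sigma>")
  case True
  show ?thesis
  proof (cases "x = 0")
    case False
    then have "nrm x powr (ln \<sigma> / ln \<pi>n) \<le> nrm x powr 1"
      by (intro powr_mono' ln_scale_pos[OF True assms(2)] nrm_nonneg assms(3))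
    then show ?thesis using False by (simp add: vabs_pos_scale[OF True] nrm_nonneg)
  qed (simp add: vabs_zero nrm_nonneg)
next
  case False
  then have "\<sigma> = 0" using assms by simp
  then show ?thesis by (simp add: vabs_0_scale nrm_nonneg)
qed

lemma continuous_on_vabs:
  assumes "S \<subseteq> {0..}" "S \<subseteq> {0<..} \<or> nrm x \<le> 1"
  shows "continuous_on S (\<lambda>\<sigma>. vabs \<sigma> x)"
proof (cases "nrm x = 1 \<or> x = 0")
  case False
  have "0 < ln (nrm x) / ln \<pi>n" if "nrm x \<le> 1"
    using that False ln_\<pi>n_neg nrm_pos_iff[of x] by (simp add: zero_less_divide_iff)
  then have "continuous_on S (\<lambda>\<sigma>. \<sigma> powr (ln (nrm x) / ln \<pi>n))"
    using assms by (intro continuous_on_powr' continuous_intros) (auto simp: subset_iff)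
  then show ?thesis using False by (simp add: vabs_def)
next
  case True
  then have "vabs \<sigma> x = (if nrm x = 1 then 1 else 0)" for \<sigma>
    by (auto simp: vabs_def)
  then show ?thesis by simp
qed

abbreviation Aff :: "('r poly \<Rightarrow> real) set" where "Aff \<equiv> affine_line nrm"

lemma AffI:
  assumes "ultrametric_abs l" "\<And>a. l [:a:] \<le> nrm (to_fract a)"
  shows "l \<in> Aff"
proof -
  have "l 1 \<noteq> 0" using ua_1[OF assms(1)] by simp
  then show ?thesis
    unfolding affine_line_def frac_embed_eq_to_fract
    using ultrametric_abs_imp_seminorm[OF assms(1)] assms(2) by blast
qed

lemma Aff_const_le: "l \<in> Aff \<Longrightarrow> l [:a:] \<le> nrm (to_fract a)"
  by (simp add: affine_line_def frac_embed_eq_to_fract)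

lemma Aff_const_le_1: "l \<in> Aff \<Longrightarrow> l [:a:] \<le> 1"
  using Aff_const_le nrm_to_fract_le_1 order_trans by blast

text \<open>
  Integers have norm at most 1, so all binomial coefficients have value at most 1. By the binomial
  theorem \<open>l (f + g)\<^sup>n \<le> (n + 1) M\<^sup>n\<close> for the maximum \<open>M\<close> of \<open>l f\<close> and \<open>l g\<close>, which for large \<open>n\<close> is
  incompatible with \<open>l (f + g) > M\<close>.
\<close>

lemma Aff_ultrametric_abs:
  assumes l: "l \<in> Aff"
  shows "ultrametric_abs l"
proof -
  have nonneg: "0 \<le> l f" and zero: "l 0 = 0" and tri: "l (f + g) \<le> l f + l g"
    and mult: "l (f * g) = l f * l g" for f g
    using l unfolding affine_line_def multiplicative_seminorm_def by auto
  obtain f0 where "l f0 \<noteq> 0" using l by (auto simp: affine_line_def)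
  then have one: "l 1 = 1" using mult[of 1 f0] by simp
  have power: "l (f ^ n) = l f ^ n" for f n by (induction n) (simp_all add: one mult)
  have sum: "l (sum h A) \<le> (\<Sum>i\<in>A. l (h i))" for h :: "nat \<Rightarrow> 'r poly" and A
  proof (induction A rule: infinite_finite_induct)
    case (insert i A)
    then show ?case using tri[of "h i" "sum h A"] by simp
  qed (auto simp: zero)
  have "l (f + g) \<le> max (l f) (l g)" for f g
  proof (rule ccontr)
    define M where "M = max (l f) (l g)"
    assume "\<not> l (f + g) \<le> max (l f) (l g)"
    then have less: "M < l (f + g)" by (simp only: M_def not_le)
    have M: "0 \<le> M" "l f \<le> M" "l g \<le> M" using nonneg by (auto simp: M_def le_max_iff_disj)
    have "M \<noteq> 0" using less tri[of f g] M by auto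
    then have Mpos: "0 < M" using M by simp
    define x where "x = l (f + g) / M"
    have x: "1 < x" using less Mpos by (simp add: x_def)
    have bound: "x ^ n \<le> real n + 1" for n
    proof -
      have "l (f + g) ^ n = l (\<Sum>k\<le>n. of_nat (n choose k) * f ^ k * g ^ (n - k))"
        by (simp add: power[symmetric] binomial_ring)
      also have "\<dots> \<le> (\<Sum>k\<le>n. l (of_nat (n choose k) * f ^ k * g ^ (n - k)))"
        by (rule sum)
      also have "\<dots> \<le> (\<Sum>k\<le>n. M ^ n)"
      proof (rule sum_mono)
        fix k assume k: "k \<in> {..n}"
        have "l (of_nat (n choose k)) \<le> 1"
          using Aff_const_le_1[OF l] by (simp add: of_nat_poly)
        moreover have "l f ^ k * l g ^ (n - k) \<le> M ^ k * M ^ (n - k)"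
          using nonneg M by (intro mult_mono power_mono) auto
        moreover have "M ^ k * M ^ (n - k) = M ^ n" using k by (simp flip: power_add)
        ultimately have "l (of_nat (n choose k)) * (l f ^ k * l g ^ (n - k)) \<le> 1 * M ^ n"
          using nonneg by (intro mult_mono) auto
        then show "l (of_nat (n choose k) * f ^ k * g ^ (n - k)) \<le> M ^ n"
          by (simp add: mult power mult.assoc)
      qed
      also have "\<dots> = (real n + 1) * M ^ n" by (simp add: algebra_simps)
      finally show ?thesis using Mpos by (simp add: x_def power_divide divide_le_eq)
    qed
    \<comment> \<open>Bernoulli for the square root of \<open>x\<close> gives quadratic growth of the powers of \<open>x\<close>, enough
      to beat \<open>n + 1\<close>.\<close>
    define d where "d = sqrt x - 1"
    have d: "0 < d" using x by (simp add: d_def)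
    obtain n where n: "1 / d\<^sup>2 < real n" using reals_Archimedean2 by blast
    then have nd: "1 < real n * d\<^sup>2" using d by (simp add: divide_less_eq)
    have "1 + real n * d \<le> (1 + d) ^ n" using d by (intro Bernoulli_inequality) simp
    then have "(1 + real n * d)\<^sup>2 \<le> ((1 + d) ^ n)\<^sup>2" using d by (intro power_mono) auto
    also have "\<dots> = x ^ n" using x by (simp add: d_def power2_eq_square flip: power_mult_distrib)
    also have "\<dots> \<le> real n + 1" by (rule bound)
    finally have "2 * (real n * d) + real n * (real n * d\<^sup>2) \<le> real n"
      by (simp add: power2_eq_square algebra_simps)
    moreover have "real n * 1 \<le> real n * (real n * d\<^sup>2)"
      using nd by (intro mult_left_mono) auto
    moreover have "0 < real n * d"
      using nd d by (metis mult_zero_left not_one_less_zero of_nat_0 of_nat_0_less_iff gr0I mult_pos_pos)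
    ultimately show False by simp
  qed
  then show ?thesis using nonneg zero one mult by (simp add: ultrametric_abs_def)
qed

lemma Aff_scale_bounds: "l \<in> Aff \<Longrightarrow> 0 \<le> l [:\<pi>:]" "l \<in> Aff \<Longrightarrow> l [:\<pi>:] \<le> \<pi>n"
  using ua_nonneg[OF Aff_ultrametric_abs] Aff_const_le by auto

lemma Aff_const_mult: "l \<in> Aff \<Longrightarrow> l [:a * b:] = l [:a:] * l [:b:]"
  using ua_mult[OF Aff_ultrametric_abs, of l "[:a:]" "[:b:]"] by (simp add: mult.commute)

lemma Aff_const_power: "l \<in> Aff \<Longrightarrow> l [:a ^ n:] = l [:a:] ^ n"
  using ua_power[OF Aff_ultrametric_abs, of l "[:a:]" n] by (simp add: poly_const_pow)

lemma Aff_const_mono: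
  assumes l: "l \<in> Aff" and le: "nrm (to_fract a) \<le> nrm (to_fract b)"
  shows "l [:a:] \<le> l [:b:]"
proof (cases "b = 0")
  case True
  then have "a = 0" using le nrm_nonneg[of "to_fract a"] by (simp add: nrm_eq_0_iff[THEN iffD2] nrm_eq_0_iff)
  then show ?thesis using True by simp
next
  case False
  then have "nrm (to_fract a / to_fract b) \<le> 1"
    using le nrm_pos_iff[of "to_fract b"] by (simp add: nrm_divide)
  then obtain d where "to_fract a / to_fract b = to_fract d" by (rule nrm_le_1E)
  then have "to_fract a = to_fract (b * d)" using False by (simp add: field_simps)
  then have "a = b * d" by (simp only: to_fract_eq_iff)
  then show ?thesis
    using Aff_const_mult[OF l, of b d] Aff_const_le_1[OF l, of d]
      ua_nonneg[OF Aff_ultrametric_abs[OF l]] by (simp add: mult_left_le)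
qed

lemma nrm_power: "nrm (x ^ n) = nrm x ^ n"
  by (rule ua_power[OF nrm_ultrametric_abs])

lemma to_fract_power: "to_fract (a ^ n) = to_fract a ^ n"
  by (induction n) simp_all

text \<open>
  Divisibility in \<open>R\<close> turns \<open>\<bar>c\<bar>\<^sup>n \<le> \<bar>\<pi>\<bar>\<^sup>m\<close> into \<open>l c\<^sup>n \<le> (l \<pi>)\<^sup>m\<close>, and conversely. So the logarithms of \<open>l c\<close>
  and \<open>l \<pi>\<close> have the same ratio as those of \<open>\<bar>c\<bar>\<close> and \<open>\<bar>\<pi>\<bar>\<close>, as both ratios have the same rational
  approximations. This is where the rank-one condition enters.
\<close>

lemma Aff_const:
  assumes l: "l \<in> Aff"
  shows "l [:c:] = vabs (l [:\<pi>:]) (to_fract c)"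
proof -
  define \<sigma> where "\<sigma> = l [:\<pi>:]"
  define C where "C = nrm (to_fract c)"
  have \<sigma>: "0 \<le> \<sigma>" "\<sigma> \<le> \<pi>n" using Aff_scale_bounds[OF l] by (auto simp: \<sigma>_def)
  have nonneg: "0 \<le> l f" for f using ua_nonneg[OF Aff_ultrametric_abs[OF l]] .
  consider "c = 0" | "C = 1" | "c \<noteq> 0" "C < 1"
    using nrm_to_fract_le_1[of c] unfolding C_def by linarith
  then show ?thesis
  proof cases
    case 1
    then show ?thesis using ua_0[OF Aff_ultrametric_abs[OF l]] by (simp add: vabs_zero)
  next
    case 2
    have "l [:1:] \<le> l [:c:]" using 2 by (intro Aff_const_mono[OF l]) (simp add: C_def nrm_1)
    then have "l [:c:] = 1"
      using ua_1[OF Aff_ultrametric_abs[OF l]] Aff_const_le_1[OF l, of c] by (simp add: one_pCons)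
    then show ?thesis using 2 by (simp add: vabs_def C_def)
  next
    case 3
    define v where "v = ln C / ln \<pi>n"
    have C: "0 < C" using 3 by (simp add: C_def nrm_pos_iff)
    have v: "0 < v" using C 3 ln_\<pi>n_neg by (simp add: v_def zero_less_divide_iff)
    have rhs: "vabs \<sigma> (to_fract c) = \<sigma> powr v" using 3 by (simp add: vabs_def v_def C_def)
    have mono1: "l [:c:] ^ n \<le> \<sigma> ^ m" if "C ^ n \<le> \<pi>n ^ m" for n m
      using Aff_const_mono[OF l, of "c ^ n" "\<pi> ^ m"] that
      by (simp add: Aff_const_power[OF l] to_fract_power nrm_power C_def \<sigma>_def)
    have mono2: "\<sigma> ^ m \<le> l [:c:] ^ n" if "\<pi>n ^ m \<le> C ^ n" for n m
      using Aff_const_mono[OF l, of "\<pi> ^ m" "c ^ n"] that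
      by (simp add: Aff_const_power[OF l] to_fract_power nrm_power C_def \<sigma>_def)
    show ?thesis
    proof (cases "\<sigma> = 0")
      case True
      obtain n where "C ^ n < \<pi>n"
        using real_arch_pow_inv[OF \<pi>n_pos] 3 by blast
      then have "l [:c:] ^ n \<le> 0" using mono1[of n 1] True by simp
      then have "l [:c:] = 0" using nonneg[of "[:c:]"]
        by (metis order_antisym zero_le_power power_eq_0_iff)
      then show ?thesis using rhs True by (simp add: \<sigma>_def)
    next
      case False
      then have \<sigma>pos: "0 < \<sigma>" "\<sigma> < 1" using \<sigma> \<pi>_less_1 by auto
      obtain m where "\<pi>n ^ m < C" using real_arch_pow_inv[OF C] \<pi>_less_1 by blast
      then have "\<sigma> ^ m \<le> l [:c:]" using mono2[of m 1] by simp
      then have L: "0 < l [:c:]" using \<sigma>pos by (meson less_le_trans zero_less_power)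
      define s where "s = - ln \<sigma>"
      define t where "t = - ln (l [:c:])"
      have s: "0 < s" using \<sigma>pos by (simp add: s_def)
      have approx: "real n * \<bar>t - v * s\<bar> \<le> s" for n
      proof -
        define m where "m = nat \<lfloor>real n * v\<rfloor>"
        have m: "real m \<le> real n * v" "real n * v < real m + 1"
          using v by (auto simp: m_def le_nat_floor)
        have lnC: "ln C = v * ln \<pi>n" using ln_\<pi>n_neg by (simp add: v_def)
        have "real (Suc m) * ln \<pi>n \<le> (real n * v) * ln \<pi>n"
          "(real n * v) * ln \<pi>n \<le> real m * ln \<pi>n"
          using m ln_\<pi>n_neg by (auto intro!: mult_right_mono_neg)
        then have "ln (\<pi>n ^ Suc m) \<le> ln (C ^ n)" "ln (C ^ n) \<le> ln (\<pi>n ^ m)"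
          using C \<pi>n_pos by (auto simp: ln_realpow lnC mult_ac simp del: power_Suc)
        then have "\<pi>n ^ Suc m \<le> C ^ n" "C ^ n \<le> \<pi>n ^ m"
          using C \<pi>n_pos by (auto simp del: power_Suc)
        then have "\<sigma> ^ Suc m \<le> l [:c:] ^ n" "l [:c:] ^ n \<le> \<sigma> ^ m"
          using mono1 mono2 by blast+
        then have "ln (\<sigma> ^ Suc m) \<le> ln (l [:c:] ^ n)" "ln (l [:c:] ^ n) \<le> ln (\<sigma> ^ m)"
          using L \<sigma>pos by (auto simp del: power_Suc)
        then have "real n * t \<le> real (Suc m) * s" "real m * s \<le> real n * t"
          using L \<sigma>pos by (auto simp: ln_realpow s_def t_def simp del: power_Suc)
        moreover have "real m * s \<le> (real n * v) * s" "(real n * v) * s \<le> (real m + 1) * s"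
          using m s by (auto intro!: mult_right_mono)
        ultimately have "\<bar>real n * t - real n * v * s\<bar> \<le> s"
          by (simp add: abs_le_iff algebra_simps)
        then show ?thesis
          by (metis abs_mult abs_of_nat mult.assoc right_diff_distrib)
      qed
      have "t = v * s"
      proof (rule ccontr)
        assume "t \<noteq> v * s"
        then have "0 < \<bar>t - v * s\<bar>" by simp
        then obtain n where "s < real n * \<bar>t - v * s\<bar>"
          using reals_Archimedean3 by blast
        then show False using approx[of n] by simp
      qed
      then have "ln (l [:c:]) = v * ln \<sigma>" by (simp add: t_def s_def)
      then have "l [:c:] = \<sigma> powr v" using L \<sigma>pos by (metis exp_ln powr_def less_irrefl)
      then show ?thesis using rhs by (simp add: \<sigma>_def)
    qed
  qed
qed

end

section \<open>Linear factors, points of evaluation, and the flow\<close>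
lemma poly_fract_poly_to_fract: "poly (fract_poly f) (to_fract a) = to_fract (poly f a)"
  by (induction f) (simp_all add: map_poly_pCons)

context nontrivial_valuation
begin

lemma nrm_poly_le_1:
  assumes "nrm \<alpha> \<le> 1"
  shows "nrm (poly (fract_poly f) \<alpha>) \<le> 1"
proof -
  obtain a where "\<alpha> = to_fract a" using assms by (rule nrm_le_1E)
  then show ?thesis by (simp add: poly_fract_poly_to_fract nrm_to_fract_le_1)
qed

definition eval_abs :: "'r fract \<Rightarrow> real \<Rightarrow> 'r poly \<Rightarrow> real" where
  "eval_abs \<alpha> \<sigma> f = vabs \<sigma> (poly (fract_poly f) \<alpha>)"

lemma eval_abs_const: "eval_abs \<alpha> \<sigma> [:c:] = vabs \<sigma> (to_fract c)"
  by (simp add: eval_abs_def map_poly_pCons)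

lemma eval_abs_Aff:
  assumes "0 \<le> \<sigma>" "\<sigma> \<le> \<pi>n" "0 < \<sigma> \<or> nrm \<alpha> \<le> 1"
  shows "eval_abs \<alpha> \<sigma> \<in> Aff"
proof (rule AffI)
  have adm: "0 < \<sigma> \<or> nrm (poly (fract_poly f) \<alpha>) \<le> 1 \<and> nrm (poly (fract_poly g) \<alpha>) \<le> 1" for f g
    using assms(3) nrm_poly_le_1 by blast
  show "ultrametric_abs (eval_abs \<alpha> \<sigma>)"
    unfolding ultrametric_abs_def eval_abs_def
    using vabs_add[OF assms(1,2) adm] vabs_mult[OF assms(1) adm]
    by (simp add: vabs_nonneg vabs_zero vabs_one)
  show "eval_abs \<alpha> \<sigma> [:a:] \<le> nrm (to_fract a)" for a
    unfolding eval_abs_const by (rule vabs_le_nrm[OF assms(1,2) nrm_to_fract_le_1])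
qed

lemma eval_abs_scale: "0 \<le> \<sigma> \<Longrightarrow> eval_abs \<alpha> \<sigma> [:\<pi>:] = \<sigma>"
  by (simp add: eval_abs_const vabs_uniformizer)

lemma continuous_on_eval_abs:
  assumes "S \<subseteq> {0..}" "S \<subseteq> {0<..} \<or> nrm \<alpha> \<le> 1"
  shows "continuous_on S (\<lambda>\<sigma>. eval_abs \<alpha> \<sigma> f)"
  unfolding eval_abs_def using assms nrm_poly_le_1 by (intro continuous_on_vabs) auto

text \<open>
  A root of \<open>f\<close> in \<open>K\<close> either lies in \<open>R\<close> or is the inverse of some \<open>b\<close> in \<open>R\<close>. In the first case
  division by a monic linear polynomial stays in \<open>R[t]\<close>; in the second case the same holds
  after reversing the coefficients, which turns \<open>t - b\<close> into \<open>1 - bt\<close>.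
\<close>

lemma linear_factor:
  assumes deg: "0 < degree (f :: 'r poly)"
  obtains c d g where "f = [:d, c:] * g" "degree g < degree f"
proof -
  have less: "degree q < degree f" if "f = [:d, 1:] * q" for d q
  proof -
    have "q \<noteq> 0" using that deg by auto
    then have "degree f = degree [:d, 1:] + degree q"
      unfolding that by (intro degree_mult_eq) auto
    then show ?thesis by simp
  qed
  have "degree (fract_poly f) = degree f" by (intro degree_map_poly) simp
  then obtain \<alpha> where \<alpha>: "poly (fract_poly f) \<alpha> = 0"
    using alg_closed[of "fract_poly f"] deg by auto
  show ?thesis
  proof (cases "nrm \<alpha> \<le> 1")
    case True
    then obtain a where "\<alpha> = to_fract a" by (rule nrm_le_1E)
    then have "poly f a = 0" using \<alpha> by (simp add: poly_fract_poly_to_fract)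
    then obtain q where "f = [:- a, 1:] * q" by (auto simp: poly_eq_0_iff_dvd elim: dvdE)
    then show ?thesis using that less by blast
  next
    case False
    then have "\<alpha> \<noteq> 0" using nrm_eq_0_iff[of 0] by auto
    have "nrm (inverse \<alpha>) \<le> 1"
      using False nrm_divide[of 1 \<alpha>] nrm_1 by (simp add: inverse_eq_divide)
    then obtain b where b: "inverse \<alpha> = to_fract b" by (rule nrm_le_1E)
    show ?thesis
    proof (cases "coeff f 0 = 0")
      case True
      then have "poly f 0 = 0" by (simp add: poly_0_coeff_0)
      then obtain q where "f = [:0, 1:] * q" by (auto simp: poly_eq_0_iff_dvd elim: dvdE)
      then show ?thesis using that less by blast
    next
      case nz: False
      have "reflect_poly (fract_poly f) = fract_poly (reflect_poly f)"
        by (rule poly_eqI) (simp add: coeff_reflect_poly coeff_map_poly degree_map_poly)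
      then have "to_fract (poly (reflect_poly f) b) = poly (reflect_poly (fract_poly f)) (inverse \<alpha>)"
        by (simp add: poly_fract_poly_to_fract b)
      also have "\<dots> = 0"
        using \<alpha> \<open>\<alpha> \<noteq> 0\<close> by (simp add: poly_reflect_poly_nz)
      finally have "poly (reflect_poly f) b = 0" by simp
      then obtain q where q: "reflect_poly f = [:- b, 1:] * q"
        by (auto simp: poly_eq_0_iff_dvd elim: dvdE)
      have f: "f = reflect_poly [:- b, 1:] * reflect_poly q"
        by (metis q nz reflect_poly_reflect_poly reflect_poly_mult)
      have "reflect_poly [:- b, 1:] = [:1, - b:]"
        by (rule poly_eqI) (auto simp: coeff_reflect_poly coeff_pCons split: nat.split)
      then have "f = [:1, - b:] * reflect_poly q" using f by (simp only:)
      moreover have "degree (reflect_poly q) < degree f"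
      proof -
        have "q \<noteq> 0" using q deg by auto
        then have "degree (reflect_poly f) = degree [:- b, 1:] + degree q"
          unfolding q by (intro degree_mult_eq) auto
        then show ?thesis
          using degree_reflect_poly_le[of q] degree_reflect_poly_le[of f] by simp
      qed
      ultimately show ?thesis by (rule that)
    qed
  qed
qed

lemma linear_factor_induct [case_names const linear mult]:
  assumes const: "\<And>c. P [:c:]" and linear: "\<And>c d. P [:d, c:]"
    and mult: "\<And>f g. P f \<Longrightarrow> P g \<Longrightarrow> P (f * g)"
  shows "P (f :: 'r poly)"
proof (induction "degree f" arbitrary: f rule: less_induct)
  case less
  show ?case
  proof (cases "degree f = 0")
    case True
    then obtain c where "f = [:c:]" by (rule degree_eq_zeroE)
    then show ?thesis using const by simp
  next
    case False
    then have deg: "0 < degree f" by simp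
    obtain c d g where f: "f = [:d, c:] * g" and less_deg: "degree g < degree f"
      by (rule linear_factor[OF deg])
    have "P g" by (rule less[OF less_deg])
    then show ?thesis unfolding f by (rule mult[OF linear])
  qed
qed

lemma Aff_eqI:
  assumes "l \<in> Aff" "l' \<in> Aff" "l [:\<pi>:] = l' [:\<pi>:]" "\<And>c d. l [:d, c:] = l' [:d, c:]"
  shows "l = l'"
proof
  fix f show "l f = l' f"
  proof (induction f rule: linear_factor_induct)
    case (const c)
    show ?case using Aff_const[OF assms(1), of c] Aff_const[OF assms(2), of c] assms(3) by simp
  next
    case (linear c d)
    show ?case by (rule assms(4))
  next
    case (mult f g)
    then show ?case
      using Aff_ultrametric_abs[OF assms(1)] Aff_ultrametric_abs[OF assms(2)]
      by (simp add: ua_mult)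
  qed
qed

text \<open>
  For the seminorm of a disc in an algebraically closed complete field this is the seminorm of
  the disc with the same centre whose radius is the maximum of \<open>r\<close> and the old one. The formula in terms
  of the Taylor expansion needs no centre, so it applies to every point, at every scale.
\<close>

definition flow :: "('r poly \<Rightarrow> real) \<Rightarrow> real \<Rightarrow> 'r poly \<Rightarrow> real" where
  "flow l r f = gauss_norm l r (taylor_poly f)"

lemma flow_const: "l \<in> Aff \<Longrightarrow> 0 \<le> r \<Longrightarrow> flow l r [:c:] = l [:c:]"
  by (simp add: flow_def taylor_poly_const gauss_norm_const Aff_ultrametric_abs)

lemma flow_linear:
  "l \<in> Aff \<Longrightarrow> 0 \<le> r \<Longrightarrow> flow l r [:d, c:] = max (l [:d, c:]) (r * l [:c:])"
  by (simp add: flow_def taylor_poly_linear gauss_norm_linear Aff_ultrametric_abs)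

lemma flow_0: "l \<in> Aff \<Longrightarrow> flow l 0 = l"
  by (simp add: fun_eq_iff flow_def gauss_norm_0_radius Aff_ultrametric_abs coeff_taylor_poly_0)

lemma flow_Aff:
  assumes l: "l \<in> Aff" and r: "0 \<le> r"
  shows "flow l r \<in> Aff"
proof (rule AffI)
  have g: "ultrametric_abs (gauss_norm l r)"
    by (rule gauss_norm_ultrametric_abs[OF Aff_ultrametric_abs[OF l] r])
  have "taylor_poly (1 :: 'r poly) = 1" "taylor_poly (0 :: 'r poly) = 0"
    using taylor_poly_const[of "1 :: 'r"] taylor_poly_const[of "0 :: 'r"] by (simp_all add: one_pCons)
  then show "ultrametric_abs (flow l r)"
    unfolding ultrametric_abs_def flow_def
    by (simp add: taylor_poly_add taylor_poly_mult ua_nonneg[OF g] ua_0[OF g] ua_1[OF g]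
        ua_add[OF g] ua_mult[OF g])
  show "flow l r [:a:] \<le> nrm (to_fract a)" for a
    using flow_const[OF l r] Aff_const_le[OF l] by simp
qed

lemma continuous_on_flow:
  fixes L :: "'x::topological_space \<Rightarrow> 'r poly \<Rightarrow> real"
  assumes "\<And>f. continuous_on S (\<lambda>x. L x f)" and "continuous_on S r"
  shows "continuous_on S (\<lambda>x. flow (L x) (r x) f)"
  unfolding flow_def using assms by (rule continuous_on_gauss_norm)

text \<open>
  At scale 0, only units \<open>b\<close> have a non-zero value; then \<open>a / b\<close> lies in \<open>R\<close>, where
  evaluation makes sense at this scale.
\<close>

lemma admissible_centre:
  assumes l: "l \<in> Aff" and b: "0 < l [:b:]"
  shows "b \<noteq> 0" "0 < l [:\<pi>:] \<or> nrm (to_fract a / to_fract b) \<le> 1"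
proof -
  show "b \<noteq> 0" using b ua_0[OF Aff_ultrametric_abs[OF l]] by auto
  show "0 < l [:\<pi>:] \<or> nrm (to_fract a / to_fract b) \<le> 1"
  proof (cases "l [:\<pi>:] = 0")
    case True
    then have "nrm (to_fract b) = 1"
      using b Aff_const[OF l, of b] by (auto simp: vabs_0_scale split: if_splits)
    then show ?thesis by (simp add: nrm_divide nrm_to_fract_le_1)
  next
    case False
    then show ?thesis using Aff_scale_bounds(1)[OF l] by simp
  qed
qed

lemma eval_abs_linear:
  assumes l: "l \<in> Aff" and b: "0 < l [:b:]"
  shows "eval_abs (to_fract a / to_fract b) (l [:\<pi>:]) [:d, c:] = l [:b * d + a * c:] / l [:b:]"
proof -
  define x where "x = to_fract d + to_fract c * (to_fract a / to_fract b)"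
  note adm = admissible_centre(1)[OF l b] admissible_centre(2)[OF l b, of a]
  have \<sigma>: "0 \<le> l [:\<pi>:]" by (rule Aff_scale_bounds(1)[OF l])
  have x_eq: "x = poly (fract_poly [:d, c:]) (to_fract a / to_fract b)"
    by (simp add: x_def map_poly_pCons mult.commute)
  have "0 < l [:\<pi>:] \<or> nrm (to_fract b) \<le> 1 \<and> nrm x \<le> 1"
    using adm(2) nrm_poly_le_1 nrm_to_fract_le_1 unfolding x_eq by blast
  then have "vabs (l [:\<pi>:]) (to_fract b * x) = vabs (l [:\<pi>:]) (to_fract b) * vabs (l [:\<pi>:]) x"
    by (rule vabs_mult[OF \<sigma>])
  moreover have "to_fract b * x = to_fract (b * d + a * c)"
    using adm(1) by (simp add: x_def distrib_left)
  ultimately have "l [:b * d + a * c:] = l [:b:] * vabs (l [:\<pi>:]) x"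
    using Aff_const[OF l, of b] Aff_const[OF l, of "b * d + a * c"] by metis
  then show ?thesis using b by (simp add: eval_abs_def flip: x_eq)
qed

text \<open>
  Once the radius reaches the distance of \<open>l\<close> to \<open>a / b\<close>, the flow of \<open>l\<close> has merged with the flow of the
  evaluation at \<open>a / b\<close>. It suffices to compare values at linear polynomials, where the
  identity \<open>b (ct + d) = c (bt - a) + (bd + ac)\<close> and the ultrametric inequality decide.
\<close>

lemma flow_eq_flow_eval_abs:
  assumes l: "l \<in> Aff" and b: "0 < l [:b:]"
    and r: "l [:- a, b:] \<le> r * l [:b:]"
  shows "flow l r = flow (eval_abs (to_fract a / to_fract b) (l [:\<pi>:])) r"
proof -
  let ?e = "eval_abs (to_fract a / to_fract b) (l [:\<pi>:])"
  note ua = Aff_ultrametric_abs[OF l]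
  have e: "?e \<in> Aff"
    using admissible_centre(2)[OF l b] Aff_scale_bounds[OF l] by (intro eval_abs_Aff)
  have r0: "0 \<le> r"
    using r b ua_nonneg[OF ua, of "[:- a, b:]"] by (metis mult_less_0_iff not_less order_trans)
  have scale: "?e [:\<pi>:] = l [:\<pi>:]"
    using Aff_scale_bounds(1)[OF l] by (simp add: eval_abs_scale)
  show ?thesis
  proof (rule Aff_eqI)
    show "flow l r \<in> Aff" "flow ?e r \<in> Aff" using l e r0 by (auto intro: flow_Aff)
    show "flow l r [:\<pi>:] = flow ?e r [:\<pi>:]"
      using scale by (simp add: flow_const l e r0)
    fix c d
    have ec: "?e [:c:] = l [:c:]"
      by (simp only: eval_abs_const Aff_const[OF l, of c])
    define X where "X = l [:d, c:]"
    define Y where "Y = l [:b * d + a * c:]"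
    define B where "B = l [:b:]"
    define C where "C = l [:c:]"
    have C0: "0 \<le> C" using ua_nonneg[OF ua] by (simp add: C_def)
    have BX: "l ([:b:] * [:d, c:]) = B * X"
      by (simp only: ua_mult[OF ua] B_def X_def)
    have Cr: "l ([:c:] * [:- a, b:]) \<le> B * (r * C)"
    proof -
      have "C * l [:- a, b:] \<le> C * (r * B)"
        using r C0 by (intro mult_left_mono) (simp_all add: B_def)
      then show ?thesis by (simp only: ua_mult[OF ua] C_def[symmetric]) (simp add: mult_ac)
    qed
    define F where "F = [:b:] * [:d, c:]"
    define G where "G = [:c:] * [:- a, b:]"
    have "F = G + [:b * d + a * c:]" "[:b * d + a * c:] = F - G"
      by (simp_all add: F_def G_def mult_ac)
    then have "l F \<le> max (l G) Y" "Y \<le> max (l F) (l G)"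
      unfolding Y_def by (metis ua_add[OF ua], metis ua_diff[OF ua])
    then have "B * X \<le> max (B * (r * C)) Y" "Y \<le> max (B * X) (B * (r * C))"
      using Cr BX unfolding F_def[symmetric] G_def[symmetric] by (auto simp: le_max_iff_disj)
    then have eq: "max (B * X) (B * (r * C)) = max Y (B * (r * C))"
      by (auto simp: max_def split: if_splits)
    have B: "0 < B" using b by (simp add: B_def)
    have "B * max X (r * C) = B * max (Y / B) (r * C)"
      unfolding max_mult_distrib_left using B eq by simp
    then have "max X (r * C) = max (Y / B) (r * C)" using B by simp
    then show "flow l r [:d, c:] = flow ?e r [:d, c:]"
      unfolding flow_linear[OF l r0] flow_linear[OF e r0] eval_abs_linear[OF l b] ec
      by (simp only: X_def Y_def B_def C_def)
  qed
qed

section \<open>Arcs that change the scale\<close>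

lemma powr_Aff:
  assumes l: "l \<in> Aff" and u: "1 \<le> u"
  shows "(\<lambda>f. l f powr u) \<in> Aff"
proof (rule AffI)
  note ua = Aff_ultrametric_abs[OF l]
  have "l (f + g) powr u \<le> max (l f powr u) (l g powr u)" for f g
  proof -
    have "l (f + g) powr u \<le> max (l f) (l g) powr u"
      using u by (intro powr_mono2 ua_add[OF ua] ua_nonneg[OF ua]) simp
    then show ?thesis by (auto simp: max_def split: if_splits)
  qed
  then show "ultrametric_abs (\<lambda>f. l f powr u)"
    unfolding ultrametric_abs_def
    by (simp add: ua_0[OF ua] ua_1[OF ua] ua_mult[OF ua] ua_nonneg[OF ua] powr_mult)
  fix a
  have "l [:a:] powr u \<le> l [:a:] powr 1"
    using u by (intro powr_mono' ua_nonneg[OF ua] Aff_const_le_1[OF l])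
  also have "\<dots> \<le> nrm (to_fract a)"
    using Aff_const_le[OF l, of a] ua_nonneg[OF ua] by simp
  finally show "l [:a:] powr u \<le> nrm (to_fract a)" .
qed

text \<open>
  At scale 0 the point lives over the residue field with its trivial absolute value. The
  differences of centres then have value 0 or 1, so at most one residue class of centres is at distance
  less than 1, and if there is none then all centres are equally far away.
\<close>

lemma Aff_scale_0_min:
  assumes l: "l \<in> Aff" and scale: "l [:\<pi>:] = 0"
  obtains a where "\<And>a'. l [:- a, 1:] \<le> l [:- a', 1:]"
proof -
  note ua = Aff_ultrametric_abs[OF l]
  have near: "l [:- a, 1:] \<le> max (l [:- a', 1:]) (l [:a' - a:])" for a a'
    using ua_add[OF ua, of "[:- a', 1:]" "[:a' - a:]"] by simp
  have const: "l [:c:] = 0 \<or> l [:c:] = 1" for c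
    using Aff_const[OF l, of c] scale by (simp add: vabs_0_scale split: if_splits)
  have nonneg: "0 \<le> l f" for f by (rule ua_nonneg[OF ua])
  show ?thesis
  proof (cases "\<exists>a. l [:- a, 1:] < 1")
    case True
    then obtain a where a: "l [:- a, 1:] < 1" by blast
    have "l [:- a, 1:] \<le> l [:- a', 1:]" for a'
    proof (cases "l [:a' - a:] = 0")
      case True
      then show ?thesis using near[of a a'] nonneg[of "[:- a', 1:]"] by simp
    next
      case False
      then have "l [:a' - a:] = 1" using const by blast
      moreover have "l [:a' - a:] \<le> max (l [:- a, 1:]) (l [:- a', 1:])"
        using ua_diff[OF ua, of "[:- a, 1:]" "[:- a', 1:]"] by simp
      ultimately show ?thesis using a by linarith
    qed
    then show ?thesis by (rule that)
  next
    case False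
    have "l [:- 0, 1:] \<le> l [:- a', 1:]" for a'
    proof -
      have "1 \<le> l [:- a', 1:]" using False by (meson not_le)
      then show ?thesis using near[of 0 a'] Aff_const_le_1[OF l, of "a' - 0"] by linarith
    qed
    then show ?thesis by (rule that)
  qed
qed

text \<open>
  Flowing up to the least distance to a centre changes none of the distances.
\<close>

lemma Aff_scale_0_eq_flow:
  assumes l: "l \<in> Aff" and scale: "l [:\<pi>:] = 0"
  obtains a r where "0 \<le> r" "l = flow (eval_abs (to_fract a) 0) r"
proof -
  note ua = Aff_ultrametric_abs[OF l]
  obtain a where a: "\<And>a'. l [:- a, 1:] \<le> l [:- a', 1:]"
    using Aff_scale_0_min[OF l scale] by blast
  define r where "r = l [:- a, 1:]"
  have r0: "0 \<le> r" unfolding r_def by (rule ua_nonneg[OF ua])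
  have one: "l [:1:] = 1" using ua_1[OF ua] by (simp add: one_pCons)
  have "flow l r = l"
  proof (rule Aff_eqI[OF flow_Aff[OF l r0] l])
    show "flow l r [:\<pi>:] = l [:\<pi>:]" by (rule flow_const[OF l r0])
    fix c d
    have "r * l [:c:] \<le> l [:d, c:]"
    proof (cases "nrm (to_fract c) = 1")
      case True
      then have "to_fract c \<noteq> 0" using nrm_eq_0_iff[of 0] by auto
      then have "nrm (inverse (to_fract c)) \<le> 1"
        using True nrm_divide[of 1 "to_fract c"] nrm_1 by (simp add: inverse_eq_divide)
      then obtain c' where "inverse (to_fract c) = to_fract c'" by (rule nrm_le_1E)
      then have "to_fract (c * c') = to_fract 1" using \<open>to_fract c \<noteq> 0\<close>
        by (metis right_inverse to_fract_1 to_fract_mult)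
      then have cc: "c * c' = 1" by (simp only: to_fract_eq_iff)
      have "c * (c' * d) = d" using cc by (metis mult.assoc mult_1)
      then have "[:d, c:] = [:c:] * [:- (- (c' * d)), 1:]"
        using cc mult.commute[of c' c] by simp
      then have "l [:d, c:] = l [:c:] * l [:- (- (c' * d)), 1:]"
        by (metis ua_mult[OF ua])
      then show ?thesis
        using mult_left_mono[OF a ua_nonneg[OF ua, of "[:c:]"], of "- (c' * d)"]
        by (simp add: r_def mult.commute)
    next
      case False
      then have "l [:c:] = 0" using Aff_const[OF l, of c] scale by (simp add: vabs_0_scale)
      then show ?thesis by (simp add: ua_nonneg[OF ua])
    qed
    then show "flow l r [:d, c:] = l [:d, c:]" by (simp add: flow_linear[OF l r0])
  qed
  moreover have "flow l r = flow (eval_abs (to_fract a / to_fract 1) (l [:\<pi>:])) r"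
    by (rule flow_eq_flow_eval_abs[OF l]) (simp_all add: one r_def)
  ultimately show ?thesis using that[OF r0, of a] scale by simp
qed

text \<open>
  At positive scale one raises \<open>l\<close> to powers with exponents between 1 and 2. Powers do not change the
  scale 0; there \<open>l\<close> is written as the flow of an evaluation, whose scale is then increased.
\<close>

lemma scale_path:
  assumes l: "l \<in> Aff"
  obtains g where "path g" "path_image g \<subseteq> Aff" "pathstart g = l"
    "inj_on (\<lambda>x. g x [:\<pi>:]) {0..1}"
proof (cases "l [:\<pi>:] = 0")
  case True
  then obtain a r where r: "0 \<le> r" and l_eq: "l = flow (eval_abs (to_fract a) 0) r"
    using Aff_scale_0_eq_flow[OF l] by blast
  define g where "g x = flow (eval_abs (to_fract a) (x * \<pi>n)) r" for x
  have eval: "eval_abs (to_fract a) (x * \<pi>n) \<in> Aff" if "x \<in> {0..1}" for x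
    using that \<pi>n_pos nrm_to_fract_le_1[of a] by (intro eval_abs_Aff) (auto simp: mult_left_le_one_le)
  have scale: "g x [:\<pi>:] = x * \<pi>n" if "x \<in> {0..1}" for x
    using that \<pi>n_pos by (simp add: g_def flow_const[OF eval r] eval_abs_scale)
  show ?thesis
  proof (rule that)
    have "continuous_on {0..1} (\<lambda>x. eval_abs (to_fract a) (x * \<pi>n) f)" for f
      using \<pi>n_pos nrm_to_fract_le_1[of a]
      by (intro continuous_on_compose2[OF continuous_on_eval_abs[of "{0..}" "to_fract a" f]]
          continuous_intros) auto
    then show "path g"
      unfolding g_def by (intro path_function_space continuous_on_flow continuous_intros)
    show "path_image g \<subseteq> Aff"
      using flow_Aff[OF eval r] by (auto simp: path_image_def g_def)
    show "pathstart g = l" by (simp add: pathstart_def g_def l_eq)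
    show "inj_on (\<lambda>x. g x [:\<pi>:]) {0..1}"
      using \<pi>n_pos by (auto simp: inj_on_def scale)
  qed
next
  case False
  then have pos: "0 < l [:\<pi>:]" "l [:\<pi>:] < 1"
    using Aff_scale_bounds[OF l] \<pi>_less_1 by auto
  note ua = Aff_ultrametric_abs[OF l]
  define g where "g x f = l f powr (1 + x)" for x :: real and f
  show ?thesis
  proof (rule that)
    have "continuous_on {0..1} (\<lambda>x. l f powr (1 + x))" for f
      by (cases "l f = 0") (auto intro!: continuous_intros)
    then show "path g" unfolding g_def by (intro path_function_space)
    show "path_image g \<subseteq> Aff"
    proof
      fix y assume "y \<in> path_image g"
      then obtain x where x: "0 \<le> x" "y = g x" by (auto simp: path_image_def)
      then have "y = (\<lambda>f. l f powr (1 + x))" by (simp add: g_def fun_eq_iff)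
      then show "y \<in> Aff" using powr_Aff[OF l, of "1 + x"] x(1) by simp
    qed
    show "pathstart g = l"
      unfolding pathstart_def by (rule ext) (simp add: g_def ua_nonneg[OF ua])
    show "inj_on (\<lambda>x. g x [:\<pi>:]) {0..1}"
      using pos by (auto simp: inj_on_def g_def powr_inj)
  qed
qed

lemma local_scale_path:
  assumes W: "openin (top_of_set Aff) W" and l: "l \<in> W"
  obtains g where "path g" "path_image g \<subseteq> W" "pathstart g = l"
    "inj_on (\<lambda>x. g x [:\<pi>:]) {0..1}"
proof -
  have "l \<in> Aff" using W l openin_imp_subset by blast
  then obtain g where g: "path g" "path_image g \<subseteq> Aff" "pathstart g = l"
    "inj_on (\<lambda>x. g x [:\<pi>:]) {0..1}" by (rule scale_path)
  obtain T where T: "open T" "W = Aff \<inter> T" using W by (auto simp: openin_open)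
  have "openin (top_of_set {0..1}) ({0..1} \<inter> g -` T)"
    using g(1) T(1) unfolding path_def by (rule continuous_openin_preimage_gen)
  moreover have "0 \<in> {0..1} \<inter> g -` T" using g(3) l T by (simp add: pathstart_def)
  ultimately obtain e where e: "0 < e" "ball 0 e \<inter> {0..1} \<subseteq> {0..1} \<inter> g -` T"
    by (meson openin_contains_ball)
  define s where "s = min 1 (e / 2)"
  have s: "0 < s" "s \<le> 1" "s < e" using e(1) by (auto simp: s_def)
  have in01: "s * x \<in> {0..1}" "s * x \<in> ball 0 e" if "x \<in> {0..1}" for x
  proof -
    have "s * x \<le> s" "0 \<le> s * x" using that s by (simp_all add: mult_left_le)
    then have "s * x \<le> 1" "0 \<le> s * x" "s * x < e" using s by linarith+
    then show "s * x \<in> {0..1}" "s * x \<in> ball 0 e" by (simp_all add: dist_real_def)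
  qed
  show ?thesis
  proof (rule that)
    show "path (\<lambda>x. g (s * x))"
      unfolding path_def
    proof (rule continuous_on_compose2[OF g(1)[unfolded path_def]])
      show "continuous_on {0..1} (\<lambda>x. s * x)" by (intro continuous_intros)
      show "(\<lambda>x. s * x) ` {0..1} \<subseteq> {0..1}" using in01(1) by blast
    qed
    show "path_image (\<lambda>x. g (s * x)) \<subseteq> W"
    proof
      fix y assume "y \<in> path_image (\<lambda>x. g (s * x))"
      then obtain x where x: "x \<in> {0..1}" "y = g (s * x)" by (auto simp: path_image_def)
      have "g (s * x) \<in> Aff" using g(2) in01(1)[OF x(1)] by (auto simp: path_image_def)
      moreover have "g (s * x) \<in> T" using e(2) in01[OF x(1)] by blast
      ultimately show "y \<in> W" using T x by simp
    qed
    show "pathstart (\<lambda>x. g (s * x)) = l" using g(3) by (simp add: pathstart_def)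
    show "inj_on (\<lambda>x. g (s * x) [:\<pi>:]) {0..1}"
    proof (rule inj_onI)
      fix x y assume xy: "x \<in> {0..1}" "y \<in> {0..1}" "g (s * x) [:\<pi>:] = g (s * y) [:\<pi>:]"
      then have "s * x = s * y" using inj_onD[OF g(4)] in01(1) by blast
      then show "x = y" using s by simp
    qed
  qed
qed

section \<open>A neighbourhood basis\<close>

text \<open>
  Centres in \<open>K\<close> are kept as fractions \<open>(a, b)\<close>: a point of the line is a seminorm on \<open>R[t]\<close>, and at scale 0
  it does not extend to \<open>K[t]\<close>.
\<close>

definition centre :: "'r \<times> 'r \<Rightarrow> 'r fract" where
  "centre z = to_fract (fst z) / to_fract (snd z)"

definition centre_dist :: "('r poly \<Rightarrow> real) \<Rightarrow> 'r \<times> 'r \<Rightarrow> real" where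
  "centre_dist l z = l [:- fst z, snd z:] / l [:snd z:]"

definition tube :: "('r poly \<Rightarrow> real) \<Rightarrow> ('r \<times> 'r) set \<Rightarrow> real \<Rightarrow> real \<Rightarrow> ('r poly \<Rightarrow> real) set" where
  "tube m A \<epsilon> \<delta> = {l \<in> Aff. \<bar>l [:\<pi>:] - m [:\<pi>:]\<bar> < \<delta> \<and>
     (\<forall>z\<in>A. 0 < l [:snd z:] \<and> \<bar>centre_dist l z - centre_dist m z\<bar> < \<epsilon>)}"

lemma tube_self:
  assumes "m \<in> Aff" "\<And>z. z \<in> A \<Longrightarrow> 0 < m [:snd z:]" "0 < \<epsilon>" "0 < \<delta>"
  shows "m \<in> tube m A \<epsilon> \<delta>"
  using assms by (simp add: tube_def)

lemma openin_tube:
  assumes "finite A"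
  shows "openin (top_of_set Aff) (tube m A \<epsilon> \<delta>)"
proof -
  define T where "T z = {l :: 'r poly \<Rightarrow> real. 0 < l [:snd z:]} \<inter>
    {l. \<bar>l [:- fst z, snd z:] - centre_dist m z * l [:snd z:]\<bar> < \<epsilon> * l [:snd z:]}" for z
  \<comment> \<open>Clearing the denominator in the distance describes the tube by continuous functions.\<close>
  have "open (T z)" for z
    unfolding T_def by (intro open_Int open_Collect_less continuous_intros continuous_on_coordinate)
  moreover have "l \<in> T z \<longleftrightarrow> 0 < l [:snd z:] \<and> \<bar>centre_dist l z - centre_dist m z\<bar> < \<epsilon>" for l z
  proof (cases "0 < l [:snd z:]")
    case True
    have "l [:- fst z, snd z:] - centre_dist m z * l [:snd z:] =
        (centre_dist l z - centre_dist m z) * l [:snd z:]"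
      using True by (simp add: centre_dist_def left_diff_distrib)
    then show ?thesis using True by (simp add: T_def abs_mult)
  qed (simp add: T_def)
  then have "tube m A \<epsilon> \<delta> = Aff \<inter> ({l. \<bar>l [:\<pi>:] - m [:\<pi>:]\<bar> < \<delta>} \<inter> (\<Inter>z\<in>A. T z))"
    by (auto simp: tube_def)
  moreover have "open {l :: 'r poly \<Rightarrow> real. \<bar>l [:\<pi>:] - m [:\<pi>:]\<bar> < \<delta>}"
    by (intro open_Collect_less continuous_intros continuous_on_coordinate)
  ultimately show ?thesis using assms by (auto intro!: openin_open_Int open_Int open_INT)
qed

lemma tube_mono:
  "A' \<subseteq> A \<Longrightarrow> \<epsilon> \<le> \<epsilon>' \<Longrightarrow> \<delta> \<le> \<delta>' \<Longrightarrow> tube m A \<epsilon> \<delta> \<subseteq> tube m A' \<epsilon>' \<delta>'"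
  by (fastforce simp: tube_def)

text \<open>
  The tubes form a filter base \<open>G\<close>. It converges to \<open>m\<close> at constants, whose values are continuous functions
  of the scale, and at linear polynomials, hence at all their products, which are all polynomials.
\<close>

lemma tube_basis:
  assumes U: "openin (top_of_set Aff) U" and m: "m \<in> U"
  obtains A \<epsilon> \<delta> where "finite A" "\<And>z. z \<in> A \<Longrightarrow> 0 < m [:snd z:]" "0 < \<epsilon>" "0 < \<delta>"
    "tube m A \<epsilon> \<delta> \<subseteq> U"
proof -
  have mA: "m \<in> Aff" using openin_imp_subset[OF U] m by blast
  note uam = Aff_ultrametric_abs[OF mA]
  define I :: "(('r \<times> 'r) set \<times> real \<times> real) set" where "I = {(A, \<epsilon>, \<delta>). finite A \<and> (\<forall>z\<in>A. 0 < m [:snd z:]) \<and> 0 < \<epsilon> \<and> 0 < \<delta>}"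
  define G where "G = (INF (A, \<epsilon>, \<delta>)\<in>I. principal (tube m A \<epsilon> \<delta>))"
  have G_iff: "eventually P G \<longleftrightarrow>
      (\<exists>A \<epsilon> \<delta>. (A, \<epsilon>, \<delta>) \<in> I \<and> (\<forall>l\<in>tube m A \<epsilon> \<delta>. P l))" for P
  proof -
    have "eventually P G \<longleftrightarrow> (\<exists>b\<in>I. eventually P (case b of (A, \<epsilon>, \<delta>) \<Rightarrow> principal (tube m A \<epsilon> \<delta>)))"
      unfolding G_def
    proof (rule eventually_INF_base)
      have "({}, 1, 1) \<in> I" by (simp add: I_def)
      then show "I \<noteq> {}" by blast
      fix x y assume xy: "x \<in> I" "y \<in> I"
      obtain A \<epsilon> \<delta> where x: "x = (A, \<epsilon>, \<delta>)" by (rule prod_cases3)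
      obtain A' \<epsilon>' \<delta>' where y: "y = (A', \<epsilon>', \<delta>')" by (rule prod_cases3)
      have "(A \<union> A', min \<epsilon> \<epsilon>', min \<delta> \<delta>') \<in> I" using xy by (auto simp: I_def x y)
      moreover have "tube m (A \<union> A') (min \<epsilon> \<epsilon>') (min \<delta> \<delta>') \<subseteq> tube m A \<epsilon> \<delta>"
        "tube m (A \<union> A') (min \<epsilon> \<epsilon>') (min \<delta> \<delta>') \<subseteq> tube m A' \<epsilon>' \<delta>'"
        by (rule tube_mono; simp)+
      ultimately show "\<exists>w\<in>I. (case w of (A, \<epsilon>, \<delta>) \<Rightarrow> principal (tube m A \<epsilon> \<delta>)) \<le>
          inf (case x of (A, \<epsilon>, \<delta>) \<Rightarrow> principal (tube m A \<epsilon> \<delta>))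
              (case y of (A, \<epsilon>, \<delta>) \<Rightarrow> principal (tube m A \<epsilon> \<delta>))"
        by (intro bexI[of _ "(A \<union> A', min \<epsilon> \<epsilon>', min \<delta> \<delta>')"]) (simp_all add: x y)
    qed
    then show ?thesis by (simp add: Bex_def split_paired_Ex eventually_principal Ball_def)
  qed
  have in_Aff: "\<forall>\<^sub>F l in G. l \<in> Aff"
    unfolding G_iff by (intro exI[of _ "{}"] exI[of _ 1]) (auto simp: I_def tube_def)
  have lim_scale: "((\<lambda>l. l [:\<pi>:]) \<longlongrightarrow> m [:\<pi>:]) G"
  proof (rule tendstoI)
    fix e :: real assume "0 < e"
    then show "\<forall>\<^sub>F l in G. dist (l [:\<pi>:]) (m [:\<pi>:]) < e"
      unfolding G_iff by (intro exI[of _ "{}"] exI[of _ 1] exI[of _ e])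
        (auto simp: I_def tube_def dist_real_def)
  qed
  have lim_const: "((\<lambda>l. l [:c:]) \<longlongrightarrow> m [:c:]) G" for c
  proof -
    have "((\<lambda>l. vabs (l [:\<pi>:]) (to_fract c)) \<longlongrightarrow> vabs (m [:\<pi>:]) (to_fract c)) G"
    proof (rule continuous_on_tendsto_compose[OF _ lim_scale])
      show "continuous_on {0..} (\<lambda>\<sigma>. vabs \<sigma> (to_fract c))"
        by (rule continuous_on_vabs) (simp_all add: nrm_to_fract_le_1)
      show "m [:\<pi>:] \<in> {0..}" using Aff_scale_bounds(1)[OF mA] by simp
      show "\<forall>\<^sub>F l in G. l [:\<pi>:] \<in> {0..}"
        using in_Aff by (rule eventually_mono) (simp add: Aff_scale_bounds)
    qed
    moreover have "\<forall>\<^sub>F l in G. vabs (l [:\<pi>:]) (to_fract c) = l [:c:]"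
      using in_Aff by (rule eventually_mono) (metis Aff_const)
    ultimately have "((\<lambda>l. l [:c:]) \<longlongrightarrow> vabs (m [:\<pi>:]) (to_fract c)) G"
      by (rule Lim_transform_eventually)
    then show ?thesis using Aff_const[OF mA, of c] by metis
  qed
  have lim_unit: "((\<lambda>l. l [:d, c:]) \<longlongrightarrow> m [:d, c:]) G" if c: "0 < m [:c:]" for c d
  proof -
    have "((\<lambda>l. centre_dist l (- d, c)) \<longlongrightarrow> centre_dist m (- d, c)) G"
    proof (rule tendstoI)
      fix e :: real assume "0 < e"
      then show "\<forall>\<^sub>F l in G. dist (centre_dist l (- d, c)) (centre_dist m (- d, c)) < e"
        unfolding G_iff using c
        by (intro exI[of _ "{(- d, c)}"] exI[of _ 1] exI[of _ e])
          (auto simp: I_def tube_def dist_real_def)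
    qed
    then have "((\<lambda>l. centre_dist l (- d, c) * l [:c:]) \<longlongrightarrow> centre_dist m (- d, c) * m [:c:]) G"
      by (intro tendsto_mult lim_const)
    moreover have "\<forall>\<^sub>F l in G. centre_dist l (- d, c) * l [:c:] = l [:d, c:]"
      unfolding G_iff using c
      by (intro exI[of _ "{(- d, c)}"] exI[of _ 1]) (auto simp: I_def tube_def centre_dist_def)
    ultimately have "((\<lambda>l. l [:d, c:]) \<longlongrightarrow> centre_dist m (- d, c) * m [:c:]) G"
      by (rule Lim_transform_eventually)
    then show ?thesis using c by (simp add: centre_dist_def)
  qed
  \<comment> \<open>A leading coefficient \<open>c\<close> with \<open>m c = 0\<close> (zero, or a non-unit at scale 0) belongs to no centre; here \<open>l (ct)\<close>
    tends to 0, so only the constant term matters.\<close>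
  have lim_small: "((\<lambda>l. l [:d, c:]) \<longlongrightarrow> m [:d, c:]) G" if c: "m [:c:] = 0" for c d
  proof -
    have diff: "\<bar>l [:d, c:] - l [:d:]\<bar> \<le> l [:c:] * l [:0, 1:]" if l: "l \<in> Aff" for l
    proof -
      note ua = Aff_ultrametric_abs[OF l]
      have "[:d, c:] = [:d:] + [:c:] * [:0, 1:]" "[:d:] = [:d, c:] - [:c:] * [:0, 1:]" by simp_all
      then have "l [:d, c:] \<le> max (l [:d:]) (l ([:c:] * [:0, 1:]))"
        "l [:d:] \<le> max (l [:d, c:]) (l ([:c:] * [:0, 1:]))"
        by (metis ua_add[OF ua], metis ua_diff[OF ua])
      then show ?thesis
        using ua_nonneg[OF ua, of "[:d:]"] ua_nonneg[OF ua, of "[:d, c:]"]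
          ua_nonneg[OF ua, of "[:c:] * [:0, 1:]"] ua_mult[OF ua, of "[:c:]" "[:0, 1:]"]
        by linarith
    qed
    have "0 < m [:1:]" using ua_1[OF uam] by (simp add: one_pCons)
    then have "((\<lambda>l. l [:c:] * l [:0, 1:]) \<longlongrightarrow> m [:c:] * m [:0, 1:]) G"
      by (intro tendsto_mult lim_const lim_unit)
    then have "((\<lambda>l. l [:c:] * l [:0, 1:]) \<longlongrightarrow> 0) G" using c by simp
    then have "((\<lambda>l. l [:d, c:] - l [:d:]) \<longlongrightarrow> 0) G"
    proof (rule Lim_null_comparison[rotated])
      show "\<forall>\<^sub>F l in G. norm (l [:d, c:] - l [:d:]) \<le> l [:c:] * l [:0, 1:]"
        using in_Aff by (rule eventually_mono) (simp add: diff)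
    qed
    then have "((\<lambda>l. (l [:d, c:] - l [:d:]) + l [:d:]) \<longlongrightarrow> 0 + m [:d:]) G"
      by (intro tendsto_add lim_const)
    moreover have "m [:d, c:] = m [:d:]" using diff[OF mA] c by simp
    ultimately show ?thesis by simp
  qed
  have lim: "((\<lambda>l. l f) \<longlongrightarrow> m f) G" for f
  proof (induction f rule: linear_factor_induct)
    case (const c)
    show ?case by (rule lim_const)
  next
    case (linear c d)
    show ?case
      using lim_unit[of c d] lim_small[of c d] ua_nonneg[OF uam, of "[:c:]"] by fastforce
  next
    case (mult f g)
    have "((\<lambda>l. l f * l g) \<longlongrightarrow> m f * m g) G" using mult by (rule tendsto_mult)
    moreover have "\<forall>\<^sub>F l in G. l f * l g = l (f * g)"
      using in_Aff by (rule eventually_mono) (simp add: ua_mult[OF Aff_ultrametric_abs])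
    ultimately have "((\<lambda>l. l (f * g)) \<longlongrightarrow> m f * m g) G"
      by (rule Lim_transform_eventually)
    then show ?case by (simp add: ua_mult[OF uam])
  qed
  obtain T where T: "open T" "U = Aff \<inter> T" using U by (auto simp: openin_open)
  have "\<forall>\<^sub>F l in G. l \<in> T"
    using m T lim by (intro eventually_open_function_space[of T m]) auto
  then obtain A \<epsilon> \<delta> where "(A, \<epsilon>, \<delta>) \<in> I" "\<forall>l\<in>tube m A \<epsilon> \<delta>. l \<in> T"
    unfolding G_iff by blast
  moreover have "tube m A \<epsilon> \<delta> \<subseteq> Aff" by (auto simp: tube_def)
  ultimately show ?thesis using that[of A \<epsilon> \<delta>] T by (auto simp: I_def)
qed

lemma centre_dist_nonneg: "l \<in> Aff \<Longrightarrow> 0 \<le> centre_dist l z"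
  by (simp add: centre_dist_def ua_nonneg[OF Aff_ultrametric_abs])

lemma centre_dist_flow:
  assumes "l \<in> Aff" "0 < l [:snd z:]" "0 \<le> r"
  shows "centre_dist (flow l r) z = max (centre_dist l z) r"
proof -
  have "max (l [:- fst z, snd z:]) (r * l [:snd z:]) / l [:snd z:] = max (centre_dist l z) r"
    using assms(2) by (auto simp: centre_dist_def max_def field_simps)
  then show ?thesis
    by (simp only: centre_dist_def flow_linear[OF assms(1,3)] flow_const[OF assms(1,3)])
qed

lemma vabs_pos:
  assumes "0 < \<sigma> \<or> nrm x = 1" "x \<noteq> 0"
  shows "0 < vabs \<sigma> x"
  using assms by (auto simp: vabs_def)

lemma centre_dist_eval_abs:
  assumes "0 \<le> \<sigma>" "0 < \<sigma> \<or> nrm \<alpha> \<le> 1 \<and> nrm (to_fract (snd z)) = 1" "snd z \<noteq> 0"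
  shows "centre_dist (eval_abs \<alpha> \<sigma>) z = vabs \<sigma> (\<alpha> - centre z)"
proof -
  have z: "0 < vabs \<sigma> (to_fract (snd z))" using assms by (intro vabs_pos) auto
  have eq: "poly (fract_poly [:- fst z, snd z:]) \<alpha> = to_fract (snd z) * (\<alpha> - centre z)"
    using assms(3) by (simp add: map_poly_pCons centre_def right_diff_distrib mult.commute)
  have "nrm (\<alpha> - centre z) \<le> 1" if "nrm \<alpha> \<le> 1" "nrm (to_fract (snd z)) = 1"
  proof -
    have "nrm (centre z) \<le> 1" using that by (simp add: centre_def nrm_divide nrm_to_fract_le_1)
    then show ?thesis
      using ua_diff[OF nrm_ultrametric_abs, of \<alpha> "centre z"] that by linarith
  qed
  then have "eval_abs \<alpha> \<sigma> [:- fst z, snd z:] = vabs \<sigma> (to_fract (snd z)) * vabs \<sigma> (\<alpha> - centre z)"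
    unfolding eval_abs_def eq using assms(1,2) nrm_to_fract_le_1 by (intro vabs_mult) auto
  then show ?thesis using z by (simp add: centre_dist_def eval_abs_const)
qed

section \<open>Tubes remain path connected without their centre\<close>

text \<open>
  The picture is a plane strip \<open>J \<times> I\<close> of scales and radii, embedded by \<open>Z\<close> as the flows of the evaluation
  at a centre \<open>\<alpha>\<close> nearest to \<open>m\<close>. Away from the scale of \<open>m\<close>, every point of the tube ascends into the
  strip without meeting \<open>m\<close>, and points of the strip are joined by a polygon that crosses the
  scale of \<open>m\<close> at a radius different from that of \<open>m\<close>.
\<close>

lemma tube_delete_path_connected:
  assumes m: "m \<in> Aff" and A: "finite A" "A \<noteq> {}" "\<And>z. z \<in> A \<Longrightarrow> 0 < m [:snd z:]"
    and \<epsilon>: "0 < \<epsilon>" and \<delta>0: "0 < \<delta>0"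
  obtains \<delta> where "0 < \<delta>" "\<delta> \<le> \<delta>0" "path_connected (tube m A \<epsilon> \<delta> - {m})"
proof -
  define \<sigma>0 where "\<sigma>0 = m [:\<pi>:]"
  have \<sigma>0: "0 \<le> \<sigma>0" "\<sigma>0 \<le> \<pi>n" using Aff_scale_bounds[OF m] by (auto simp: \<sigma>0_def)
  have \<sigma>0_cases: "\<sigma>0 = 0 \<or> 0 < \<sigma>0" using \<sigma>0(1) by auto
  obtain z1 where z1: "z1 \<in> A" "\<And>z. z \<in> A \<Longrightarrow> centre_dist m z1 \<le> centre_dist m z"
    using ex_min_if_finite[of "centre_dist m ` A"] A(1,2) by (force simp: not_less)
  define \<alpha> where "\<alpha> = centre z1"
  define \<rho> where "\<rho> = centre_dist m z1"
  have \<rho>0: "0 \<le> \<rho>" unfolding \<rho>_def by (rule centre_dist_nonneg[OF m])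
  have snd_nz: "snd z \<noteq> 0" if "z \<in> A" for z
    by (rule admissible_centre(1)[OF m A(3)[OF that]])
  have unit: "nrm (to_fract (snd z)) = 1" if "\<sigma>0 = 0" "z \<in> A" for z
    using A(3)[OF that(2)] Aff_const[OF m, of "snd z"] that(1)
    by (auto simp: \<sigma>0_def vabs_0_scale split: if_splits)
  have \<alpha>_int: "nrm \<alpha> \<le> 1" if "\<sigma>0 = 0"
    using unit[OF that z1(1)] by (simp add: \<alpha>_def centre_def nrm_divide nrm_to_fract_le_1)
  have centre_int: "nrm (\<alpha> - centre z) \<le> 1" if "\<sigma>0 = 0" "z \<in> A" for z
    using ua_diff[OF nrm_ultrametric_abs, of \<alpha> "centre z"] \<alpha>_int[OF that(1)] unit[OF that]
      nrm_to_fract_le_1[of "fst z"] by (simp add: centre_def nrm_divide)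
  \<comment> \<open>Seen from the other centres, \<open>m\<close> looks like a disc around its nearest centre. So do the points of
    the strip, and this keeps them in the tube.\<close>
  have m_dist: "centre_dist m z = max (vabs \<sigma>0 (\<alpha> - centre z)) \<rho>" if z: "z \<in> A" for z
  proof -
    have e: "eval_abs \<alpha> \<sigma>0 \<in> Aff" using \<sigma>0 \<sigma>0_cases \<alpha>_int by (intro eval_abs_Aff) auto
    have "flow m \<rho> = flow (eval_abs \<alpha> \<sigma>0) \<rho>"
      unfolding \<alpha>_def centre_def \<sigma>0_def using A(3)[OF z1(1)]
      by (intro flow_eq_flow_eval_abs[OF m]) (simp_all add: \<rho>_def centre_dist_def)
    moreover have "0 < eval_abs \<alpha> \<sigma>0 [:snd z:]"
      using A(3)[OF z] Aff_const[OF m, of "snd z"] by (simp add: eval_abs_const \<sigma>0_def)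
    ultimately have "max (centre_dist m z) \<rho> = max (centre_dist (eval_abs \<alpha> \<sigma>0) z) \<rho>"
      using centre_dist_flow[OF m A(3)[OF z] \<rho>0] centre_dist_flow[OF e _ \<rho>0, of z] by simp
    moreover have "centre_dist (eval_abs \<alpha> \<sigma>0) z = vabs \<sigma>0 (\<alpha> - centre z)"
    proof (rule centre_dist_eval_abs[OF \<sigma>0(1) _ snd_nz[OF z]])
      show "0 < \<sigma>0 \<or> nrm \<alpha> \<le> 1 \<and> nrm (to_fract (snd z)) = 1"
        using \<sigma>0_cases \<alpha>_int unit[OF _ z] by blast
    qed
    ultimately show ?thesis using z1(2)[OF z] by (simp add: \<rho>_def max_def split: if_splits)
  qed
  \<comment> \<open>If the scale of \<open>m\<close> is positive, centres outside \<open>R\<close> may occur, for which the function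
    \<open>\<sigma> \<mapsto> vabs \<sigma> x\<close> explodes near 0; so the scales have to stay positive.\<close>
  obtain \<delta>1 where \<delta>1: "0 < \<delta>1" "\<And>\<sigma> z. \<bar>\<sigma> - \<sigma>0\<bar> < \<delta>1 \<Longrightarrow> (if \<sigma>0 = 0 then 0 \<le> \<sigma> else 0 < \<sigma>) \<Longrightarrow>
      z \<in> A \<Longrightarrow> \<bar>vabs \<sigma> (\<alpha> - centre z) - vabs \<sigma>0 (\<alpha> - centre z)\<bar> < \<epsilon>"
  proof -
    define S :: "real set" where "S = {\<sigma>. if \<sigma>0 = 0 then 0 \<le> \<sigma> else 0 < \<sigma>}"
    have "\<forall>\<^sub>F \<sigma> in at \<sigma>0 within S. \<forall>z\<in>A. \<bar>vabs \<sigma> (\<alpha> - centre z) - vabs \<sigma>0 (\<alpha> - centre z)\<bar> < \<epsilon>"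
    proof (rule eventually_ball_finite[OF A(1)], rule ballI)
      fix z assume z: "z \<in> A"
      have "continuous_on S (\<lambda>\<sigma>. vabs \<sigma> (\<alpha> - centre z))"
        using centre_int[OF _ z] by (intro continuous_on_vabs) (auto simp: S_def split: if_splits)
      moreover have "\<sigma>0 \<in> S" using \<sigma>0 by (simp add: S_def)
      ultimately have "((\<lambda>\<sigma>. vabs \<sigma> (\<alpha> - centre z)) \<longlongrightarrow> vabs \<sigma>0 (\<alpha> - centre z)) (at \<sigma>0 within S)"
        by (simp add: continuous_on_def)
      from tendstoD[OF this \<epsilon>]
      show "\<forall>\<^sub>F \<sigma> in at \<sigma>0 within S. \<bar>vabs \<sigma> (\<alpha> - centre z) - vabs \<sigma>0 (\<alpha> - centre z)\<bar> < \<epsilon>"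
        by (simp add: dist_real_def)
    qed
    then obtain d where "0 < d" and d: "\<And>\<sigma> z. \<sigma> \<in> S \<Longrightarrow> \<sigma> \<noteq> \<sigma>0 \<Longrightarrow> dist \<sigma> \<sigma>0 < d \<Longrightarrow> z \<in> A \<Longrightarrow>
        \<bar>vabs \<sigma> (\<alpha> - centre z) - vabs \<sigma>0 (\<alpha> - centre z)\<bar> < \<epsilon>"
      unfolding eventually_at by blast
    show ?thesis
    proof (rule that[OF \<open>0 < d\<close>])
      fix \<sigma> z assume "\<bar>\<sigma> - \<sigma>0\<bar> < d" "if \<sigma>0 = 0 then 0 \<le> \<sigma> else 0 < \<sigma>" "z \<in> A"
      then show "\<bar>vabs \<sigma> (\<alpha> - centre z) - vabs \<sigma>0 (\<alpha> - centre z)\<bar> < \<epsilon>"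
        using d[of \<sigma> z] \<epsilon> by (cases "\<sigma> = \<sigma>0") (simp_all add: S_def dist_real_def)
    qed
  qed
  define \<delta> where "\<delta> = min \<delta>0 (min \<delta>1 (if \<sigma>0 = 0 then 1 else \<sigma>0))"
  have \<delta>: "0 < \<delta>" "\<delta> \<le> \<delta>0" "\<delta> \<le> \<delta>1" "\<sigma>0 \<noteq> 0 \<Longrightarrow> \<delta> \<le> \<sigma>0"
    using \<delta>0 \<delta>1(1) \<sigma>0 by (auto simp: \<delta>_def)
  define J where "J = {0..\<pi>n} \<inter> {\<sigma>0 - \<delta><..<\<sigma>0 + \<delta>}"
  define I where "I = {0..} \<inter> {\<rho> - \<epsilon><..<\<rho> + \<epsilon>}"
  define W where "W = tube m A \<epsilon> \<delta>"
  have W_open: "openin (top_of_set Aff) W" unfolding W_def by (rule openin_tube[OF A(1)])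
  have J_pos: "0 < \<sigma>" if "\<sigma> \<in> J" "\<sigma>0 \<noteq> 0" for \<sigma>
    using that \<delta>(4) by (auto simp: J_def)
  have J_eval: "eval_abs \<alpha> \<sigma> \<in> Aff" if "\<sigma> \<in> J" for \<sigma>
    using that J_pos[OF that] \<alpha>_int by (intro eval_abs_Aff) (auto simp: J_def)
  have J_dist: "centre_dist (eval_abs \<alpha> \<sigma>) z = vabs \<sigma> (\<alpha> - centre z)" if "\<sigma> \<in> J" "z \<in> A" for \<sigma> z
  proof (rule centre_dist_eval_abs[OF _ _ snd_nz[OF that(2)]])
    show "0 \<le> \<sigma>" using that(1) by (simp add: J_def)
    show "0 < \<sigma> \<or> nrm \<alpha> \<le> 1 \<and> nrm (to_fract (snd z)) = 1"
      using J_pos[OF that(1)] \<alpha>_int unit[OF _ that(2)] by blast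
  qed
  have J_unit: "0 < eval_abs \<alpha> \<sigma> [:snd z:]" if "\<sigma> \<in> J" "z \<in> A" for \<sigma> z
    unfolding eval_abs_const using J_pos[OF that(1)] unit[OF _ that(2)] snd_nz[OF that(2)]
    by (intro vabs_pos) auto
  have W_J: "l [:\<pi>:] \<in> J" and W_I: "centre_dist l z1 \<in> I" if "l \<in> W" for l
  proof -
    have "l \<in> Aff" "\<bar>l [:\<pi>:] - \<sigma>0\<bar> < \<delta>"
      and "\<forall>z\<in>A. \<bar>centre_dist l z - centre_dist m z\<bar> < \<epsilon>"
      using that by (simp_all add: W_def tube_def \<sigma>0_def)
    then have l: "l \<in> Aff" "\<bar>l [:\<pi>:] - \<sigma>0\<bar> < \<delta>" "\<bar>centre_dist l z1 - \<rho>\<bar> < \<epsilon>"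
      using z1(1) unfolding \<rho>_def by blast+
    show "l [:\<pi>:] \<in> J" using l Aff_scale_bounds[OF l(1)] by (auto simp: J_def)
    show "centre_dist l z1 \<in> I" using l centre_dist_nonneg[OF l(1)] by (auto simp: I_def)
  qed

  define Z where "Z x = flow (eval_abs \<alpha> (fst x)) (snd x)" for x
  have Z_scale: "Z x [:\<pi>:] = fst x" if "x \<in> J \<times> I" for x
  proof -
    have "fst x \<in> J" "0 \<le> snd x" "0 \<le> fst x" using that by (auto simp: I_def J_def)
    then show ?thesis by (simp add: Z_def flow_const[OF J_eval] eval_abs_scale)
  qed
  have Z_dist: "centre_dist (Z x) z = max (vabs (fst x) (\<alpha> - centre z)) (snd x)"
    if "x \<in> J \<times> I" "z \<in> A" for x z
  proof -
    have x: "fst x \<in> J" "0 \<le> snd x" using that(1) by (auto simp: I_def)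
    show ?thesis
      unfolding Z_def using centre_dist_flow[OF J_eval[OF x(1)] J_unit[OF x(1) that(2)] x(2)]
      by (simp add: J_dist[OF x(1) that(2)])
  qed
  have Z_dist1: "centre_dist (Z x) z1 = snd x" if "x \<in> J \<times> I" for x
    using Z_dist[OF that z1(1)] that by (auto simp: \<alpha>_def vabs_zero I_def)
  have Z_W: "Z x \<in> W" if x: "x \<in> J \<times> I" for x
  proof -
    have x': "fst x \<in> J" "0 \<le> snd x" "\<bar>snd x - \<rho>\<bar> < \<epsilon>" using x by (auto simp: I_def)
    have sc: "\<bar>fst x - \<sigma>0\<bar> < \<delta>" using x'(1) by (auto simp: J_def)
    have "\<bar>centre_dist (Z x) z - centre_dist m z\<bar> < \<epsilon>" if z: "z \<in> A" for z
    proof -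
      have "\<bar>vabs (fst x) (\<alpha> - centre z) - vabs \<sigma>0 (\<alpha> - centre z)\<bar> < \<epsilon>"
        using sc \<delta>(3) z x'(1) J_pos[OF x'(1)] by (intro \<delta>1(2)) (auto simp: J_def)
      then show ?thesis unfolding Z_dist[OF x z] m_dist[OF z] using x'(3) by linarith
    qed
    moreover have "0 < Z x [:snd z:]" if "z \<in> A" for z
      unfolding Z_def using J_unit[OF x'(1) that] by (simp add: flow_const[OF J_eval[OF x'(1)] x'(2)])
    moreover have "Z x \<in> Aff"
      unfolding Z_def by (rule flow_Aff[OF J_eval[OF x'(1)] x'(2)])
    ultimately show ?thesis
      using sc Z_scale[OF x] by (simp add: W_def tube_def flip: \<sigma>0_def)
  qed
  have Z_segment: "path_component (W - {m}) (Z x) (Z y)"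
    if x: "x \<in> J \<times> I" and y: "y \<in> J \<times> I" and avoid: "(\<sigma>0, \<rho>) \<notin> closed_segment x y" for x y
  proof -
    have "convex (J \<times> I)" unfolding J_def I_def by (intro convex_Times convex_Int) auto
    then have seg: "closed_segment x y \<subseteq> J \<times> I" using x y by (rule closed_segment_subset[rotated 2])
    have contZ: "continuous_on (J \<times> I) (\<lambda>x. Z x f)" for f
    proof -
      have "continuous_on J (\<lambda>\<sigma>. eval_abs \<alpha> \<sigma> f)" for f
      proof (rule continuous_on_eval_abs)
        show "J \<subseteq> {0..}" by (auto simp: J_def)
        show "J \<subseteq> {0<..} \<or> nrm \<alpha> \<le> 1" using \<alpha>_int J_pos by blast
      qed
      then have "continuous_on (J \<times> I) (\<lambda>x. eval_abs \<alpha> (fst x) f)" for f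
        by (rule continuous_on_compose2) (auto intro: continuous_intros)
      then show ?thesis
        unfolding Z_def by (intro continuous_on_flow continuous_intros)
    qed
    have im: "linepath x y t \<in> closed_segment x y" if "t \<in> {0..1}" for t
      using that path_image_linepath[of x y] unfolding path_image_def by blast
    have "path (Z \<circ> linepath x y)"
    proof (rule path_function_space)
      fix f
      show "continuous_on {0..1} (\<lambda>t. (Z \<circ> linepath x y) t f)"
        unfolding comp_def using im seg
        by (intro continuous_on_compose2[OF contZ] continuous_on_linepath) blast
    qed
    moreover have "path_image (Z \<circ> linepath x y) \<subseteq> W - {m}"
    proof
      fix l assume "l \<in> path_image (Z \<circ> linepath x y)"
      then obtain w where w: "w \<in> closed_segment x y" "l = Z w"
        by (auto simp: path_image_compose)
      then have wJI: "w \<in> J \<times> I" using seg by blast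
      have "Z w \<noteq> m"
      proof
        assume "Z w = m"
        then have "w = (\<sigma>0, \<rho>)"
          using Z_scale[OF wJI] Z_dist1[OF wJI] by (simp add: \<sigma>0_def \<rho>_def prod_eq_iff)
        then show False using avoid w(1) by simp
      qed
      then show "l \<in> W - {m}" using Z_W[OF wJI] w(2) by simp
    qed
    ultimately have "path_component (W - {m}) (pathstart (Z \<circ> linepath x y)) (pathfinish (Z \<circ> linepath x y))"
      by (rule path_componentI)
    then show ?thesis by (simp add: pathstart_compose pathfinish_compose)
  qed
  have Z_connected: "path_component (W - {m}) (Z (s, r)) (Z (s', r'))"
    if J: "s \<in> J" "s' \<in> J" "s \<noteq> \<sigma>0" "s' \<noteq> \<sigma>0" and I: "r \<in> I" "r' \<in> I" for s s' r r'
  proof -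
    \<comment> \<open>A radius different from that of \<open>m\<close>, at which the scale of \<open>m\<close> may be crossed.\<close>
    define q where "q = \<rho> + \<epsilon> / 2"
    have q: "q \<in> I" "q \<noteq> \<rho>" using \<rho>0 \<epsilon> by (auto simp: q_def I_def)
    have "path_component (W - {m}) (Z (s, r)) (Z (s, q))"
      using J I q by (intro Z_segment) (auto dest: closed_segment_PairD)
    moreover have "path_component (W - {m}) (Z (s, q)) (Z (s', q))"
      using J I q by (intro Z_segment) (auto dest: closed_segment_PairD)
    moreover have "path_component (W - {m}) (Z (s', q)) (Z (s', r'))"
      using J I q by (intro Z_segment) (auto dest: closed_segment_PairD)
    ultimately show ?thesis by (meson path_component_trans)
  qed
  have ascend: "path_component (W - {m}) l (Z (l [:\<pi>:], centre_dist l z1))"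
    if l: "l \<in> W" and scale: "l [:\<pi>:] \<noteq> \<sigma>0" for l
  proof -
    define r where "r = centre_dist l z1"
    have lA: "l \<in> Aff" using l by (simp add: W_def tube_def)
    have r: "0 \<le> r" "r < \<rho> + \<epsilon>" using W_I[OF l] by (auto simp: r_def I_def)
    define g where "g x = flow l (x * r)" for x
    have xr: "0 \<le> x * r" "x * r \<le> r" if "x \<in> {0..1}" for x
      using that r by (auto simp: mult_left_le_one_le)
    have "path g"
      unfolding g_def by (intro path_function_space continuous_on_flow continuous_intros)
    moreover have "path_image g \<subseteq> W - {m}"
    proof
      fix k assume "k \<in> path_image g"
      then obtain x where x: "x \<in> {0..1}" "k = flow l (x * r)"
        by (auto simp: path_image_def g_def)
      have const: "k [:c:] = l [:c:]" for c
        unfolding x(2) by (rule flow_const[OF lA xr(1)[OF x(1)]])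
      have "\<bar>centre_dist k z - centre_dist m z\<bar> < \<epsilon>" if z: "z \<in> A" for z
      proof -
        have lz: "0 < l [:snd z:]" "\<bar>centre_dist l z - centre_dist m z\<bar> < \<epsilon>"
          using l z by (auto simp: W_def tube_def)
        \<comment> \<open>The radius stays below \<open>\<rho> + \<epsilon>\<close>, and \<open>\<rho>\<close> is the least distance of \<open>m\<close> to the centres.\<close>
        have "x * r < centre_dist m z + \<epsilon>"
          using xr(2)[OF x(1)] r(2) z1(2)[OF z] by (simp add: \<rho>_def)
        then show ?thesis
          unfolding x(2) centre_dist_flow[OF lA lz(1) xr(1)[OF x(1)]] using lz(2) by linarith
      qed
      moreover have "k \<in> Aff" unfolding x(2) by (rule flow_Aff[OF lA xr(1)[OF x(1)]])
      ultimately have "k \<in> W" using l by (simp add: W_def tube_def const)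
      moreover have "k \<noteq> m" using scale const[of \<pi>] by (auto simp: \<sigma>0_def)
      ultimately show "k \<in> W - {m}" by simp
    qed
    ultimately have "path_component (W - {m}) (pathstart g) (pathfinish g)"
      by (rule path_componentI)
    moreover have "pathstart g = l" by (simp add: pathstart_def g_def flow_0[OF lA])
    moreover have "pathfinish g = Z (l [:\<pi>:], r)"
    proof -
      have b: "0 < l [:snd z1:]" using l z1(1) by (simp add: W_def tube_def)
      have "flow l r = flow (eval_abs (to_fract (fst z1) / to_fract (snd z1)) (l [:\<pi>:])) r"
        by (rule flow_eq_flow_eval_abs[OF lA b]) (use b in \<open>simp add: r_def centre_dist_def\<close>)
      then show ?thesis by (simp add: pathfinish_def g_def Z_def \<alpha>_def centre_def)
    qed
    ultimately show ?thesis by (simp add: r_def)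
  qed
  have to_Z: "\<exists>s r. s \<in> J \<and> s \<noteq> \<sigma>0 \<and> r \<in> I \<and> path_component (W - {m}) l (Z (s, r))"
    if l: "l \<in> W - {m}" for l
  proof -
    have "\<exists>k. k \<in> W \<and> k [:\<pi>:] \<noteq> \<sigma>0 \<and> path_component (W - {m}) l k"
    proof (cases "l [:\<pi>:] = \<sigma>0")
      case False
      then show ?thesis using l path_component_refl[OF l] by (intro exI[of _ l]) simp
    next
      case True
      \<comment> \<open>The ascent might run through \<open>m\<close>, so the scale is changed first.\<close>
      obtain g where g: "path g" "path_image g \<subseteq> W" "pathstart g = l"
        "inj_on (\<lambda>x. g x [:\<pi>:]) {0..1}"
        using local_scale_path[OF W_open, of l] l by blast
      have ne: "g x [:\<pi>:] \<noteq> \<sigma>0" if "x \<in> {0..1}" "x \<noteq> 0" for x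
        using inj_onD[OF g(4), of x 0] that True g(3) by (auto simp: pathstart_def)
      have "path_image g \<subseteq> W - {m}"
      proof
        fix k assume k: "k \<in> path_image g"
        then obtain x where x: "x \<in> {0..1}" "k = g x" by (auto simp: path_image_def)
        have "k \<noteq> m"
          using ne[OF x(1)] x(2) g(3) l by (cases "x = 0") (auto simp: pathstart_def \<sigma>0_def)
        then show "k \<in> W - {m}" using k g(2) by blast
      qed
      then have "path_component (W - {m}) l (pathfinish g)"
        using path_componentI[OF g(1)] g(3) by simp
      moreover have "pathfinish g \<in> W" using g(2) by auto
      moreover have "pathfinish g [:\<pi>:] \<noteq> \<sigma>0" using ne[of 1] by (simp add: pathfinish_def)
      ultimately show ?thesis by blast
    qed
    then obtain k where k: "k \<in> W" "k [:\<pi>:] \<noteq> \<sigma>0" "path_component (W - {m}) l k" by blast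
    then show ?thesis
      using ascend[OF k(1,2)] W_J[OF k(1)] W_I[OF k(1)] by (meson path_component_trans)
  qed
  have "path_connected (W - {m})"
    unfolding path_connected_component
  proof (intro ballI)
    fix l l' assume "l \<in> W - {m}" "l' \<in> W - {m}"
    then obtain s r s' r' where
      "s \<in> J" "s \<noteq> \<sigma>0" "r \<in> I" "path_component (W - {m}) l (Z (s, r))"
      "s' \<in> J" "s' \<noteq> \<sigma>0" "r' \<in> I" "path_component (W - {m}) l' (Z (s', r'))"
      using to_Z by meson
    then show "path_component (W - {m}) l l'"
      using Z_connected[of s s' r r'] by (meson path_component_sym path_component_trans)
  qed
  then show ?thesis using that[OF \<delta>(1,2)] by (simp add: W_def)
qed

lemma punctured_nbhds_Aff: "punctured_nbhds Aff"
  unfolding punctured_nbhds_def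
proof (intro allI impI)
  fix U m assume U: "openin (top_of_set Aff) U" and mU: "m \<in> U"
  have m: "m \<in> Aff" using openin_imp_subset[OF U] mU by blast
  obtain A \<epsilon> \<delta>0 where A: "finite A" "\<And>z. z \<in> A \<Longrightarrow> 0 < m [:snd z:]" "0 < \<epsilon>" "0 < \<delta>0"
    "tube m A \<epsilon> \<delta>0 \<subseteq> U" using tube_basis[OF U mU] by blast
  define B where "B = insert (0, 1) A"
  have one: "0 < m [:1:]" using ua_1[OF Aff_ultrametric_abs[OF m]] by (simp add: one_pCons)
  have B: "finite B" "B \<noteq> {}" "\<And>z. z \<in> B \<Longrightarrow> 0 < m [:snd z:]"
    using A(1,2) one by (auto simp: B_def)
  obtain \<delta> where \<delta>: "0 < \<delta>" "\<delta> \<le> \<delta>0" "path_connected (tube m B \<epsilon> \<delta> - {m})"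
    using tube_delete_path_connected[OF m B A(3,4)] by blast
  define W where "W = tube m B \<epsilon> \<delta>"
  have W_open: "openin (top_of_set Aff) W" unfolding W_def by (rule openin_tube[OF B(1)])
  have mW: "m \<in> W" unfolding W_def by (rule tube_self[OF m B(3) A(3) \<delta>(1)])
  have "W \<subseteq> tube m A \<epsilon> \<delta>0" unfolding W_def using \<delta>(2) by (intro tube_mono) (auto simp: B_def)
  then have WU: "W \<subseteq> U" using A(5) by blast
  obtain g where g: "path g" "path_image g \<subseteq> W" "pathstart g = m"
    "inj_on (\<lambda>x. g x [:\<pi>:]) {0..1}" by (rule local_scale_path[OF W_open mW])
  have k: "path_component W m (g 1)" "g 1 \<in> W - {m}"
  proof -
    show "path_component W m (g 1)"
      using path_componentI[OF g(1,2)] g(3) by (simp add: pathfinish_def)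
    have "g 1 \<noteq> g 0" using inj_onD[OF g(4), of 1 0] by force
    then show "g 1 \<in> W - {m}" using g(2,3) by (auto simp: path_image_def pathstart_def)
  qed
  have reach: "path_component W (g 1) l" if "l \<in> W" for l
  proof (cases "l = m")
    case True
    then show ?thesis using k(1) path_component_sym by blast
  next
    case False
    then have "path_component (W - {m}) (g 1) l"
      using \<delta>(3) k(2) that unfolding W_def[symmetric] path_connected_component by blast
    then show ?thesis by (rule path_component_of_subset[rotated]) blast
  qed
  then have "path_connected W"
    unfolding path_connected_component by (meson path_component_sym path_component_trans)
  then show "\<exists>W. openin (top_of_set Aff) W \<and> m \<in> W \<and> W \<subseteq> U \<and> path_connected W \<and>
      path_connected (W - {m})"
    using W_open mW WU \<delta>(3) unfolding W_def by blast
qed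

text \<open>
  Going out along an injective path up to time \<open>s\<close> and back gives a different image for each \<open>s\<close>.
\<close>

lemma infinite_loops:
  assumes V: "openin (top_of_set Aff) V" and l: "l \<in> V"
  shows "infinite (joining_paths V l l)"
proof -
  obtain g where g: "path g" "path_image g \<subseteq> V" "pathstart g = l"
    "inj_on (\<lambda>x. g x [:\<pi>:]) {0..1}" by (rule local_scale_path[OF V l])
  have inj: "inj_on g {0..1}"
    using g(4) by (auto simp: inj_on_def)
  have "g ` {0..s} \<in> joining_paths V l l" if s: "s \<in> {0<..1}" for s
  proof -
    define h where "h x = g (s * x)" for x
    have sub: "(\<lambda>x. s * x) ` {0..1} = {0..s}"
      using s image_mult_atLeastAtMost[of s 0 1] by simp
    have "path h"
      unfolding path_def h_def
    proof (rule continuous_on_compose2[OF g(1)[unfolded path_def]])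
      show "continuous_on {0..1} (\<lambda>x. s * x)" by (intro continuous_intros)
      show "(\<lambda>x. s * x) ` {0..1} \<subseteq> {0..1}" unfolding sub using s by auto
    qed
    then have "path (h +++ reversepath h)" by (intro path_join_imp path_reversepath[THEN iffD2]) auto
    moreover have im: "path_image h = g ` {0..s}"
      unfolding path_image_def h_def sub[symmetric] by (simp add: image_image)
    then have "path_image (h +++ reversepath h) = g ` {0..s}"
      by (simp add: path_image_join)
    moreover have "g ` {0..s} \<subseteq> V" using g(2) s by (force simp: path_image_def)
    moreover have "pathstart (h +++ reversepath h) = l" "pathfinish (h +++ reversepath h) = l"
      using g(3) by (simp_all add: pathstart_def h_def pathfinish_def joinpaths_def reversepath_def)
    ultimately show ?thesis
      unfolding joining_paths_def by (intro CollectI exI[of _ "h +++ reversepath h"]) simp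
  qed
  then have "(\<lambda>s. g ` {0..s}) ` {0<..1} \<subseteq> joining_paths V l l" by blast
  moreover have "inj_on (\<lambda>s. g ` {0..s}) {0<..1}"
  proof (rule inj_onI)
    fix s t :: real assume st: "s \<in> {0<..1}" "t \<in> {0<..1}" "g ` {0..s} = g ` {0..t}"
    then have "{0..s} = {0..t}"
      using inj_on_image_eq_iff[OF inj, of "{0..s}" "{0..t}"] by auto
    then show "s = t" using st by auto
  qed
  then have "infinite ((\<lambda>s. g ` {0..s}) ` {0<..1::real})"
    using infinite_Ioc[of "0::real" 1] by (simp add: finite_image_iff)
  ultimately show ?thesis using finite_subset by blast
qed

text \<open>
  An interior point of each arc is removed; an arc in what remains differs from all of them.
\<close>

lemma infinite_arcs:
  assumes V: "openin (top_of_set Aff) V" "connected V" and l: "l1 \<in> V" "l2 \<in> V" and ne: "l1 \<noteq> l2"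
  shows "infinite (joining_paths V l1 l2)"
proof
  assume fin: "finite (joining_paths V l1 l2)"
  have "\<exists>x. x \<in> P - {l1, l2}" if "P \<in> joining_paths V l1 l2" for P
  proof -
    obtain g where g: "P = path_image g" "arc g" "pathstart g = l1" "pathfinish g = l2"
      using \<open>P \<in> joining_paths V l1 l2\<close> ne unfolding joining_paths_def by auto
    have "inj_on g {0..1}" using g(2) by (simp add: arc_def)
    then have "g (1/2) \<noteq> g 0" "g (1/2) \<noteq> g 1" by (auto dest: inj_onD)
    moreover have "g (1/2) \<in> P" using g(1) by (auto simp: path_image_def)
    ultimately show ?thesis using g(3,4) by (auto simp: pathstart_def pathfinish_def)
  qed
  then obtain c where c: "\<And>P. P \<in> joining_paths V l1 l2 \<Longrightarrow> c P \<in> P - {l1, l2}" by metis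
  define M where "M = c ` joining_paths V l1 l2"
  have "openin (top_of_set Aff) (V - M) \<and> connected (V - M)"
    using punctured_nbhds_Aff V fin
    by (intro punctured_nbhds_connected_Diff_finite closed_singleton_function_space)
      (simp_all add: M_def)
  then have "path_connected (V - M)"
    using punctured_nbhds_path_connected[OF punctured_nbhds_Aff] by blast
  moreover have "l1 \<in> V - M" "l2 \<in> V - M" using l c by (auto simp: M_def)
  ultimately obtain p where p: "path p" "path_image p \<subseteq> V - M" "pathstart p = l1" "pathfinish p = l2"
    unfolding path_connected_def by blast
  then obtain q where q: "arc q" "path_image q \<subseteq> path_image p" "pathstart q = l1" "pathfinish q = l2"
    using path_contains_arc_function_space[OF p(1)] ne by metis
  have sub: "path_image q \<subseteq> V - M" using p(2) q(2) by blast
  have mem: "path_image q \<in> joining_paths V l1 l2"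
    unfolding joining_paths_def using q sub arc_imp_path[OF q(1)] by blast
  have "c (path_image q) \<in> path_image q" using c[OF mem] by blast
  moreover have "c (path_image q) \<in> M" using mem by (simp add: M_def)
  ultimately show False using sub by blast
qed

end

theorem mainTheorem4:
  fixes nrm :: "'r::idom fract \<Rightarrow> real"
    and V :: "('r poly \<Rightarrow> real) set"
    and l1 l2 :: "'r poly \<Rightarrow> real"
  assumes "complete_valuation_ring nrm"
    and not_field: "\<exists>a::'r. a \<noteq> 0 \<and> \<not> (\<exists>b. a * b = 1)"
    and alg_closed: "\<forall>p :: 'r fract poly. degree p > 0 \<longrightarrow> (\<exists>x. poly p x = 0)"
    and V_open: "openin (top_of_set (affine_line nrm)) V"
    and V_connected: "connected V"
    and "l1 \<in> V" and "l2 \<in> V"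
  shows "infinite (joining_paths V l1 l2)"
proof -
  interpret complete_valuation_ring nrm by fact
  obtain \<pi> :: 'r where \<pi>: "\<pi> \<noteq> 0" "\<nexists>b. \<pi> * b = 1" using not_field by blast
  have "nrm (to_fract \<pi>) < 1"
  proof (rule ccontr)
    assume "\<not> nrm (to_fract \<pi>) < 1"
    moreover have "nrm (to_fract \<pi>) * nrm (inverse (to_fract \<pi>)) = nrm (1 * 1)"
      using \<pi>(1) by (simp flip: nrm_mult)
    moreover have "nrm 1 = 1" using nrm_mult[of 1 1] nrm_eq_0_iff[of 1] by simp
    ultimately have "nrm (inverse (to_fract \<pi>)) \<le> 1"
      using nrm_nonneg[of "inverse (to_fract \<pi>)"]
      by (metis mult_1 mult_right_mono not_less)
    then obtain b where "inverse (to_fract \<pi>) = to_fract b"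
      using nrm_le_1_iff by (auto simp: frac_embed_eq_to_fract)
    then have "to_fract (\<pi> * b) = to_fract 1"
      using \<pi>(1) by (metis right_inverse to_fract_1 to_fract_eq_0_iff to_fract_mult)
    then have "\<pi> * b = 1" by (simp only: to_fract_eq_iff)
    then show False using \<pi>(2) by blast
  qed
  then interpret nontrivial_valuation nrm \<pi>
    using \<pi>(1) alg_closed by unfold_locales auto
  show ?thesis
  proof (cases "l1 = l2")
    case True
    then show ?thesis using infinite_loops[OF V_open \<open>l1 \<in> V\<close>] by simp
  next
    case False
    then show ?thesis using infinite_arcs[OF V_open V_connected \<open>l1 \<in> V\<close> \<open>l2 \<in> V\<close>] by simp
  qed
qed

end
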